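(* There are absolute constants $\varepsilon_0>0$ and $C>0$ such that, for every $0<\varepsilon\le\varepsilon_0$, every $(1+\varepsilon)$-quasigeodesic $\gamma:\mathbb{R}\to\mathbb{H}$ and every bounded interval $I\subset\mathbb{R}$ of positive length, the horizontal speed $\dot\gamma_H$ of $\gamma$ satisfies $$1-C\varepsilon^{1/2}\le\Big|\frac{1}{\mathcal{L}(I)}\int_I\dot\gamma_H(s)\,ds\Big|\le 1+C\varepsilon .$$
   Context: The Heisenberg group $\mathbb{H}$ is $\mathbb{R}^3$ with product $(x,y,t)\cdot(x',y',t')=(x+x',y+y',t+t'+2(x'y-xy'))$. Left-invariant horizontal fields: $X=\partial_x+2y\,\partial_t$, $Y=\partial_y-2x\,\partial_t$. A horizontal curve is an absolutely continuous $\gamma:[\alpha,\beta]\to\mathbb{H}$ with $\dot\gamma=aX_\gamma+bY_\gamma$ a.e. for some measurable $a,b$; its length is $\int_\alpha^\beta\sqrt{a^2+b^2}$. The control distance $d(P,Q)$ is the infimum of lengths of horizontal curves joining $P$ and $Q$. A $(1+\varepsilon)$-quasigeodesic is a path $\gamma:\mathbb{R}\to\mathbb{H}$ with $(1+\varepsilon)^{-1}|s-s'|\le d(\gamma(s),\gamma(s'))\le(1+\varepsilon)|s-s'|$ for all $s,s'\in\mathbb{R}$. It is known that any quasigeodesic is horizontal, i.e. $\dot\gamma(s)=a(s)X_{\gamma(s)}+b(s)Y_{\gamma(s)}$ for a.e. $s$; its horizontal speed is $\dot\gamma_H=(a,b)\in\mathbb{R}^2$. $\mathcal{L}(I)$ is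 the Lebesgue measure of $I$ and $|\cdot|$ the Euclidean norm on $\mathbb{R}^2$. *)

theory Defs
  imports "HOL-Analysis.Analysis"
begin

text \<open>The norm of the product type is the Euclidean norm of three-space.\<close>

type_synonym heis = "real \<times> real \<times> real"

definition heis_mult :: "heis \<Rightarrow> heis \<Rightarrow> heis" where
  "heis_mult = (\<lambda>(x, y, t) (x', y', t'). (x + x', y + y', t + t' + 2 * (x' * y - x * y')))"

definition fieldX :: "heis \<Rightarrow> heis" where
  "fieldX = (\<lambda>(x, y, t). (1, 0, 2 * y))"

definition fieldY :: "heis \<Rightarrow> heis" where
  "fieldY = (\<lambda>(x, y, t). (0, 1, - 2 * x))"

text \<open>
  The group law enters the control distance only through the two fields. They are left-invariant
  because they are the velocities of right translation along the first two coordinate axes.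
\<close>

lemma fieldX_left_invariant:
  "((\<lambda>s. heis_mult P (s, 0, 0)) has_vector_derivative fieldX P) (at 0)"
  by (cases P) (auto simp: heis_mult_def fieldX_def intro!: derivative_eq_intros)

lemma fieldY_left_invariant:
  "((\<lambda>s. heis_mult P (0, s, 0)) has_vector_derivative fieldY P) (at 0)"
  by (cases P) (auto simp: heis_mult_def fieldY_def intro!: derivative_eq_intros)

text \<open>
  The finite family of non-overlapping closed intervals is a division of some
  subset of \<open>{\<alpha>..\<beta>}\<close>.
\<close>

definition abs_cont_on :: "real \<Rightarrow> real \<Rightarrow> (real \<Rightarrow> 'a::metric_space) \<Rightarrow> bool" where
  "abs_cont_on \<alpha> \<beta> f \<longleftrightarrow>
     (\<forall>e>0. \<exists>\<delta>>0. \<forall>\<D> S. \<D> division_of S \<and> S \<subseteq> {\<alpha>..\<beta>} \<and> (\<Sum>K\<in>\<D>. Sup K - Inf K) < \<delta> \<longrightarrow>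
        (\<Sum>K\<in>\<D>. dist (f (Sup K)) (f (Inf K))) < e)"

definition horizontal_curve ::
  "real \<Rightarrow> real \<Rightarrow> (real \<Rightarrow> heis) \<Rightarrow> (real \<Rightarrow> real) \<Rightarrow> (real \<Rightarrow> real) \<Rightarrow> bool" where
  "horizontal_curve \<alpha> \<beta> \<gamma> a b \<longleftrightarrow>
     abs_cont_on \<alpha> \<beta> \<gamma> \<and>
     a \<in> borel_measurable (lebesgue_on {\<alpha>..\<beta>}) \<and>
     b \<in> borel_measurable (lebesgue_on {\<alpha>..\<beta>}) \<and>
     (AE s in lebesgue_on {\<alpha>..\<beta>}.
        (\<gamma> has_vector_derivative a s *\<^sub>R fieldX (\<gamma> s) + b s *\<^sub>R fieldY (\<gamma> s)) (at s within {\<alpha>..\<beta>}))"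

text \<open>
  For a horizontal curve, \<open>a\<close> and \<open>b\<close> agree almost everywhere with the derivatives of
  the first two coordinates. These are integrable by absolute continuity, so the default value 0
  of the Bochner integral of a non-integrable function never occurs as a length.
\<close>

definition horizontal_length :: "real \<Rightarrow> real \<Rightarrow> (real \<Rightarrow> real) \<Rightarrow> (real \<Rightarrow> real) \<Rightarrow> real" where
  "horizontal_length \<alpha> \<beta> a b = (LINT s:{\<alpha>..\<beta>}|lebesgue. sqrt ((a s)\<^sup>2 + (b s)\<^sup>2))"

definition control_dist :: "heis \<Rightarrow> heis \<Rightarrow> real" where
  "control_dist P Q =
     Inf {horizontal_length \<alpha> \<beta> a b | \<alpha> \<beta> a b.
            \<alpha> < \<beta> \<and> (\<exists>\<gamma>. horizontal_curve \<alpha> \<beta> \<gamma> a b \<and> \<gamma> \<alpha> = P \<and> \<gamma> \<beta> = Q)}"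

definition quasigeodesic :: "real \<Rightarrow> (real \<Rightarrow> heis) \<Rightarrow> bool" where
  "quasigeodesic k \<gamma> \<longleftrightarrow>
     (\<forall>s s'. inverse k * \<bar>s - s'\<bar> \<le> control_dist (\<gamma> s) (\<gamma> s') \<and>
             control_dist (\<gamma> s) (\<gamma> s') \<le> k * \<bar>s - s'\<bar>)"

text \<open>
  At points where \<open>\<gamma>\<close> has no horizontal derivative the value is an unspecified constant;
  for a quasigeodesic these points form a null set.
\<close>

definition horizontal_speed :: "(real \<Rightarrow> heis) \<Rightarrow> real \<Rightarrow> real \<times> real" where
  "horizontal_speed \<gamma> s =
     (THE v. (\<gamma> has_vector_derivative fst v *\<^sub>R fieldX (\<gamma> s) + snd v *\<^sub>R fieldY (\<gamma> s)) (at s))"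

lemma horizontal_speed_eq:
  assumes "(\<gamma> has_vector_derivative a *\<^sub>R fieldX (\<gamma> s) + b *\<^sub>R fieldY (\<gamma> s)) (at s)"
  shows "horizontal_speed \<gamma> s = (a, b)"
  unfolding horizontal_speed_def
proof (rule the_equality)
  fix v :: "real \<times> real"
  assume "(\<gamma> has_vector_derivative fst v *\<^sub>R fieldX (\<gamma> s) + snd v *\<^sub>R fieldY (\<gamma> s)) (at s)"
  then have "fst v *\<^sub>R fieldX (\<gamma> s) + snd v *\<^sub>R fieldY (\<gamma> s) =
             a *\<^sub>R fieldX (\<gamma> s) + b *\<^sub>R fieldY (\<gamma> s)"
    using assms vector_derivative_unique_at by blast
  then show "v = (a, b)"
    by (cases v) (auto simp: fieldX_def fieldY_def split: prod.splits)
qed (use assms in simp)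

end

theory Submission
  imports Defs
begin

text \<open>
  Write \<open>z\<close> for the projection of the curve to the plane. Its displacement over \<open>[u, v]\<close> is the
  integral of the horizontal speed, and the projection does not increase distances; this gives the
  upper bound. For the lower bound put \<open>L = v - u\<close> and \<open>K = 1 / sqrt \<epsilon>\<close>. A quasigeodesic cannot stay
  in a disc of radius \<open>K L\<close> for a time much longer than \<open>K L\<close>, because there it sweeps too little
  area to make the required distance; so \<open>\<bar>z q - z v\<bar> \<ge> K L\<close> for some \<open>q\<close> with
  \<open>q - v \<le> 257 K L\<close>. Now shortcut \<open>[u, v]\<close> by its chord. This changes the third coordinate by
  \<open>O(L\<^sup>2)\<close>, which is repaired by shifting the piece over \<open>[v, q]\<close> sideways by a vector of length
  \<open>O(L / K)\<close>. Comparing the length of this competitor with the distance of its end points, the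
  chord is shorter than \<open>L\<close> by at most \<open>O(\<epsilon> K L + L / K) = O(L sqrt \<epsilon>)\<close>.
\<close>

section \<open>Lipschitz functions on the line\<close>

text \<open>The lower bound cannot be proved inside [u, v]: the horizontal lift of a full circle is
  a shortest curve, yet its displacement is zero. It is excluded because the quasigeodesic
  inequality also holds far beyond v. There a height of order L^2 is cheap to correct: moving a
  chord of length n sideways by h changes the height by 4 n h, so h of order L^2 / n suffices,
  whereas a vertical correction on the spot would cost order L. The price of waiting is the
  proportion \<epsilon> of the whole time span that the quasigeodesic inequality gives away. The
  chosen K makes the two losses of equal order, which is where the exponent 1/2 comes from. The
  analytic sections are there because horizontality of quasigeodesics is proved here, and because
  \<open>control_dist\<close> ranges over absolutely continuous curves: upper bounds on it come from
  explicit Lipschitz paths, lower bounds from integrating along every admissible curve.\<close>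

text \<open>Vitali's theorem picks disjoint intervals of small stretch inside an open
  \<open>U\<close> barely larger than \<open>E\<close>. They cover \<open>E\<close> up to a null
  set, which the Lipschitz map sends to a null set, and their images have total length at most
  \<open>p\<close> times the measure of \<open>U\<close>. The inverse \<open>g\<close> is part of
  the statement so that the estimate can be applied with \<open>f\<close> and \<open>g\<close>
  exchanged, and because it makes images of Borel sets Borel.\<close>

lemma emeasure_homeo_image_le:
  fixes f g :: "real \<Rightarrow> real"
  assumes mono: "strict_mono f" and lip: "C-lipschitz_on UNIV f" and contg: "continuous_on UNIV g"
    and gf: "\<And>x. g (f x) = x" and fg: "\<And>y. f (g y) = y"
    and E: "E \<in> sets borel" and p: "p \<ge> 0"
    and fine: "\<And>x d. x \<in> E \<Longrightarrow> d > 0 \<Longrightarrow>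
      \<exists>c r. 0 < r \<and> r < d \<and> x \<in> ball c r \<and> f (c + r) - f (c - r) \<le> p * (2 * r)"
  shows "f ` E \<in> sets borel" and "emeasure lborel (f ` E) \<le> ennreal p * emeasure lborel E"
proof -
  have image_eq: "f ` A = g -` A" for A
    using gf fg by (auto simp: image_iff) metis
  have meas: "f ` A \<in> sets borel" if "A \<in> sets borel" for A
  proof -
    have "g \<in> borel_measurable borel"
      using contg by (rule borel_measurable_continuous_onI)
    from measurable_sets[OF this that] show ?thesis
      by (simp add: image_eq)
  qed
  show "f ` E \<in> sets borel"
    by (rule meas[OF E])
  have ball_image: "f ` ball c r = {f (c - r)<..<f (c + r)}" for c r
  proof -
    have "x \<in> g -` ball c r \<longleftrightarrow> x \<in> {f (c - r)<..<f (c + r)}" for x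
      using strict_mono_less[OF mono, of "c - r" "g x"] strict_mono_less[OF mono, of "g x" "c + r"]
      by (auto simp: fg dist_real_def)
    then show ?thesis
      unfolding image_eq by blast
  qed
  have bound: "emeasure lborel (f ` E) \<le> ennreal p * (emeasure lborel E + ennreal e)" if "e > 0" for e
  proof -
    obtain U where U: "open U" "E \<subseteq> U" "emeasure lborel (U - E) < ennreal e"
      using outer_regular_lborel[OF E \<open>e > 0\<close>] by blast
    define K where "K = {(c, r). 0 < r \<and> ball c r \<subseteq> U \<and> f (c + r) - f (c - r) \<le> p * (2 * r)}"
    have "\<exists>i. i \<in> K \<and> x \<in> ball (fst i) (snd i) \<and> snd i < d" if xE: "x \<in> E" and d: "d > 0" for x d
    proof -
      obtain u where u: "u > 0" "ball x u \<subseteq> U"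
        using U xE open_contains_ball by blast
      obtain c r where cr: "0 < r" "r < min d (u/2)" "x \<in> ball c r"
          "f (c + r) - f (c - r) \<le> p * (2 * r)"
        using fine[OF xE, of "min d (u/2)"] d u by auto
      have "ball c r \<subseteq> ball x u"
        using cr by (auto simp: dist_real_def)
      then have "(c, r) \<in> K"
        using cr u by (auto simp: K_def)
      with cr show ?thesis
        by (intro exI[of _ "(c, r)"]) auto
    qed
    from Vitali_covering_theorem_balls[of E K fst snd, OF this]
    obtain D where D: "countable D" "D \<subseteq> K"
       "pairwise (\<lambda>i j. disjnt (ball (fst i) (snd i)) (ball (fst j) (snd j))) D"
       "negligible (E - (\<Union>i\<in>D. ball (fst i) (snd i)))" .
    define V where "V = (\<Union>i\<in>D. ball (fst i) (snd i))"
    have DK: "0 < snd i \<and> ball (fst i) (snd i) \<subseteq> U \<and>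
        f (fst i + snd i) - f (fst i - snd i) \<le> p * (2 * snd i)" if "i \<in> D" for i
      using subsetD[OF D(2) that] by (simp add: K_def case_prod_beta)
    have Vm: "V \<in> sets borel"
      unfolding V_def by (intro borel_open open_UN) auto
    have VU: "V \<subseteq> U"
      unfolding V_def using DK by blast
    have "negligible (f ` (E - V))"
    proof (rule negligible_locally_Lipschitz_image)
      show "negligible (E - V)"
        using D by (simp add: V_def)
      show "\<exists>T B. open T \<and> x \<in> T \<and> (\<forall>y\<in>(E - V) \<inter> T. norm (f y - f x) \<le> B * norm (y - x))" for x
        using lipschitz_onD[OF lip] by (intro exI[of _ UNIV] exI[of _ C]) (auto simp: dist_norm)
    qed simp
    then have null: "emeasure lborel (f ` (E - V)) = 0"
      using meas[of "E - V"] E Vm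
      by (simp add: negligible_iff_null_sets null_sets_completion_iff null_setsD1)
    have fV: "f ` V = (\<Union>i\<in>D. f ` ball (fst i) (snd i))"
      by (auto simp: V_def)
    have disj: "disjoint_family_on (\<lambda>i. ball (fst i) (snd i)) D"
      using D(3) by (auto simp: disjoint_family_on_def pairwise_def disjnt_def)
    have "inj f"
      using mono by (rule strict_mono_imp_inj_on)
    then have disjf: "disjoint_family_on (\<lambda>i. f ` ball (fst i) (snd i)) D"
      using disj by (simp add: disjoint_family_on_def image_Int[symmetric])
    have "emeasure lborel (f ` V) = (\<integral>\<^sup>+i. emeasure lborel (f ` ball (fst i) (snd i)) \<partial>count_space D)"
      unfolding fV using D(1) disjf meas by (intro emeasure_UN_countable) auto
    also have "\<dots> \<le> (\<integral>\<^sup>+i. ennreal p * emeasure lborel (ball (fst i) (snd i)) \<partial>count_space D)"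
    proof (rule nn_integral_mono)
      fix i assume "i \<in> space (count_space D)"
      then have i: "0 < snd i" "f (fst i + snd i) - f (fst i - snd i) \<le> p * (2 * snd i)"
        using DK by auto
      have "f (fst i - snd i) \<le> f (fst i + snd i)"
        using i by (intro strict_mono_leD[OF mono]) auto
      then show "emeasure lborel (f ` ball (fst i) (snd i)) \<le> ennreal p * emeasure lborel (ball (fst i) (snd i))"
        using i p unfolding ball_image
        by (simp add: ball_eq_greaterThanLessThan ennreal_mult[symmetric] ennreal_leI)
    qed
    also have "\<dots> = ennreal p * (\<integral>\<^sup>+i. emeasure lborel (ball (fst i) (snd i)) \<partial>count_space D)"
      by (intro nn_integral_cmult) auto
    also have "(\<integral>\<^sup>+i. emeasure lborel (ball (fst i) (snd i)) \<partial>count_space D) = emeasure lborel V"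
      unfolding V_def using D(1) disj by (intro emeasure_UN_countable[symmetric]) auto
    also have "emeasure lborel V \<le> emeasure lborel (E \<union> (U - E))"
      using VU E U by (intro emeasure_mono) auto
    also have "\<dots> \<le> emeasure lborel E + emeasure lborel (U - E)"
      using E U by (intro emeasure_subadditive) auto
    also have "\<dots> \<le> emeasure lborel E + ennreal e"
      using U(3) by (intro add_left_mono) auto
    finally have fVle: "emeasure lborel (f ` V) \<le> ennreal p * (emeasure lborel E + ennreal e)"
      by (simp add: mult_left_mono)
    have "emeasure lborel (f ` E) \<le> emeasure lborel (f ` V \<union> f ` (E - V))"
      using meas E Vm by (intro emeasure_mono) auto
    also have "\<dots> \<le> emeasure lborel (f ` V) + emeasure lborel (f ` (E - V))"
      using meas E Vm by (intro emeasure_subadditive) auto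
    finally show ?thesis
      using fVle null by (simp add: order_trans)
  qed
  show "emeasure lborel (f ` E) \<le> ennreal p * emeasure lborel E"
  proof (rule ennreal_le_epsilon)
    fix e :: real assume e: "e > 0"
    \<comment> \<open>The denominator is \<open>p + 1\<close> because \<open>p\<close> may be
      0.\<close>
    have "emeasure lborel (f ` E) \<le> ennreal p * (emeasure lborel E + ennreal (e / (p + 1)))"
      using e p by (intro bound) auto
    also have "\<dots> = ennreal p * emeasure lborel E + ennreal (p * (e / (p + 1)))"
      using e p by (simp add: distrib_left ennreal_mult[symmetric])
    also have "\<dots> \<le> ennreal p * emeasure lborel E + ennreal e"
      using e p by (intro add_left_mono ennreal_leI) (auto simp: field_simps)
    finally show "emeasure lborel (f ` E) \<le> ennreal p * emeasure lborel E + ennreal e" .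
  qed
qed

text \<open>Covering arguments control quotients over intervals with \<open>x\<close> in the
  interior. Continuity lets one endpoint tend to \<open>x\<close>, which yields the one-sided
  quotients.\<close>

lemma DERIV_of_straddle:
  fixes f :: "real \<Rightarrow> real"
  assumes cont: "isCont f x"
    and straddle: "\<And>e. e > 0 \<Longrightarrow> \<exists>d>0. \<forall>u v. u < x \<and> x < v \<and> v - u < d \<longrightarrow>
      \<bar>f v - f u - l * (v - u)\<bar> \<le> e * (v - u)"
  shows "(f has_real_derivative l) (at x)"
  unfolding has_field_derivative_def has_derivative_at_alt
proof (intro conjI allI impI)
  fix e :: real assume e: "e > 0"
  obtain d where d: "d > 0" and dd: "\<And>u v. u < x \<Longrightarrow> x < v \<Longrightarrow> v - u < d \<Longrightarrow>
      \<bar>f v - f u - l * (v - u)\<bar> \<le> e * (v - u)"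
    using straddle[OF e] by blast
  have lim_left: "((\<lambda>t. f (x - t)) \<longlongrightarrow> f x) (at_right 0)"
    and lim_right: "((\<lambda>t. f (x + t)) \<longlongrightarrow> f x) (at_right 0)"
    by (auto intro!: isCont_tendsto_compose[OF cont] tendsto_eq_intros)
  have "norm (f y - f x - l * (y - x)) \<le> e * norm (y - x)" if y: "norm (y - x) < d" for y
  proof -
    consider "y = x" | "y > x" | "y < x" by linarith
    then show ?thesis
    proof cases
      case 2
      \<comment> \<open>The term \<open>x - 0\<close> has the shape that the limit rules produce
        from \<open>x - t\<close>.\<close>
      have "\<bar>f y - f x - l * (y - (x - 0))\<bar> \<le> e * (y - (x - 0))"
      proof (rule tendsto_le)
        show "((\<lambda>t. \<bar>f y - f (x - t) - l * (y - (x - t))\<bar>) \<longlongrightarrow> \<bar>f y - f x - l * (y - (x - 0))\<bar>) (at_right 0)"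
          by (intro tendsto_intros lim_left)
        show "((\<lambda>t. e * (y - (x - t))) \<longlongrightarrow> e * (y - (x - 0))) (at_right 0)"
          by (intro tendsto_intros)
        show "\<forall>\<^sub>F t in at_right 0. \<bar>f y - f (x - t) - l * (y - (x - t))\<bar> \<le> e * (y - (x - t))"
          using eventually_at_right_less[of 0] eventually_at_right_real[of 0 "d - (y - x)"] y 2
          by (auto elim!: eventually_mono intro!: dd)
      qed simp
      with 2 show ?thesis by simp
    next
      case 3
      have "\<bar>f x - f y - l * (x + 0 - y)\<bar> \<le> e * (x + 0 - y)"
      proof (rule tendsto_le)
        show "((\<lambda>t. \<bar>f (x + t) - f y - l * (x + t - y)\<bar>) \<longlongrightarrow> \<bar>f x - f y - l * (x + 0 - y)\<bar>) (at_right 0)"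
          by (intro tendsto_intros lim_right)
        show "((\<lambda>t. e * (x + t - y)) \<longlongrightarrow> e * (x + 0 - y)) (at_right 0)"
          by (intro tendsto_intros)
        show "\<forall>\<^sub>F t in at_right 0. \<bar>f (x + t) - f y - l * (x + t - y)\<bar> \<le> e * (x + t - y)"
          using eventually_at_right_less[of 0] eventually_at_right_real[of 0 "d - (x - y)"] y 3
          by (auto elim!: eventually_mono intro!: dd)
      qed simp
      moreover have "f y - f x - l * (y - x) = - (f x - f y - l * (x + 0 - y))"
        by (simp add: algebra_simps)
      moreover have "norm (y - x) = x + 0 - y"
        using 3 by simp
      ultimately show ?thesis
        by (metis abs_minus_cancel real_norm_def)
    qed simp
  qed
  with d show "\<exists>d>0. \<forall>y. norm (y - x) < d \<longrightarrow> norm (f y - f x - l * (y - x)) \<le> e * norm (y - x)"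
    by blast
qed (rule bounded_linear_mult_right)

text \<open>Radii below \<open>inverse (Suc n)\<close> suffice, and for each \<open>n\<close> the
  admissible points form a union of open balls; the set is thus a countable intersection of open
  sets.\<close>

lemma arbitrarily_small_intervals_borel:
  fixes Q :: "real \<Rightarrow> real \<Rightarrow> bool"
  shows "{x. \<forall>d>0. \<exists>c r. 0 < r \<and> r < d \<and> x \<in> ball c r \<and> Q c r} \<in> sets borel"
proof -
  have "{x. \<forall>d>0. \<exists>c r. 0 < r \<and> r < d \<and> x \<in> ball c r \<and> Q c r} =
     (\<Inter>n::nat. \<Union>(c, r)\<in>{(c, r). 0 < r \<and> r < inverse (Suc n) \<and> Q c r}. ball c r)"
    (is "?L = ?R")
  proof
    show "?L \<subseteq> ?R"
    proof
      fix x assume "x \<in> ?L"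
      then have "\<exists>c r. 0 < r \<and> r < inverse (Suc n) \<and> x \<in> ball c r \<and> Q c r" for n
        by auto
      then show "x \<in> ?R"
        by fast
    qed
    show "?R \<subseteq> ?L"
    proof (intro subsetI CollectI allI impI)
      fix x d :: real assume x: "x \<in> ?R" and "d > 0"
      then obtain n where n: "inverse (Suc n) < d"
        using reals_Archimedean by blast
      from x obtain c r where "0 < r" "r < inverse (Suc n)" "Q c r" "x \<in> ball c r"
        by blast
      with n show "\<exists>c r. 0 < r \<and> r < d \<and> x \<in> ball c r \<and> Q c r"
        by (meson less_trans)
    qed
  qed
  also have "\<dots> \<in> sets borel"
    by (intro sets.countable_INT'' borel_open open_UN) auto
  finally show ?thesis .
qed

text \<open>Rademacher's theorem on the line. Where the lower and upper derivates of
  \<open>f\<close> differ, rationals \<open>p < q\<close> between them put the point into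
  \<open>A p \<inter> B q\<close>, and the covering estimate shows that set to be null.\<close>

lemma lipschitz_differentiable_ae:
  fixes h :: "real \<Rightarrow> real"
  assumes lip: "C-lipschitz_on UNIV h"
  obtains N where "negligible N" "\<And>x. x \<notin> N \<Longrightarrow> h differentiable (at x)"
proof -
  define D where "D = 2 * C + 1"
  \<comment> \<open>The linear term makes \<open>f\<close> an increasing bi-Lipschitz homeomorphism.\<close>
  define f where "f x = h x + (C + 1) * x" for x
  have C: "C \<ge> 0"
    using lip by (rule lipschitz_on_nonneg)
  have slope: "v - u \<le> f v - f u" "f v - f u \<le> D * (v - u)" if "u \<le> v" for u v
  proof -
    have "\<bar>h v - h u\<bar> \<le> C * (v - u)"
      using lipschitz_onD[OF lip, of v u] that by (simp add: dist_real_def)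
    moreover have "f v - f u = (h v - h u) + C * (v - u) + (v - u)"
      "D * (v - u) = C * (v - u) + C * (v - u) + (v - u)"
      by (simp_all add: f_def D_def algebra_simps)
    ultimately show "v - u \<le> f v - f u" "f v - f u \<le> D * (v - u)"
      by linarith+
  qed
  have D: "D > 0"
    using C by (simp add: D_def)
  have mono: "strict_mono f"
  proof (rule strict_monoI)
    show "f x < f y" if "x < y" for x y
      using slope(1)[of x y] that by linarith
  qed
  have flip: "D-lipschitz_on UNIV f"
  proof (rule lipschitz_onI)
    show "dist (f x) (f y) \<le> D * dist x y" for x y
      using slope[of x y] slope[of y x] by (cases "x \<le> y") (auto simp: dist_real_def)
  qed (use D in simp)
  have contf: "continuous_on UNIV f"
    using flip by (rule lipschitz_on_continuous_on)
  have "\<exists>x. f x = y" for y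
  proof -
    define m where "m = \<bar>y - f 0\<bar>"
    have "\<exists>x. - m \<le> x \<and> x \<le> m \<and> f x = y"
    proof (rule IVT')
      show "f (- m) \<le> y" "y \<le> f m"
        using slope(1)[of "- m" 0] slope(1)[of 0 m] by (auto simp: m_def)
      show "continuous_on {- m..m} f"
        using contf continuous_on_subset by blast
    qed (simp add: m_def)
    then show ?thesis by blast
  qed
  then have "\<exists>g. \<forall>y. f (g y) = y"
    by (rule choice[OF allI])
  then obtain g where fg: "f (g y) = y" for y
    by blast
  have gf: "g (f x) = x" for x
    using fg[of "f x"] strict_mono_eq[OF mono] by blast
  have gmono: "strict_mono g"
  proof (rule strict_monoI)
    show "g x < g y" if "x < y" for x y
      using strict_mono_less[OF mono, of "g x" "g y"] that by (simp add: fg)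
  qed
  have glip: "1-lipschitz_on UNIV g"
  proof (rule lipschitz_onI)
    show "dist (g x) (g y) \<le> 1 * dist x y" for x y
      using slope(1)[of "g x" "g y"] slope(1)[of "g y" "g x"]
      by (cases "g x \<le> g y") (auto simp: dist_real_def fg)
  qed simp
  have contg: "continuous_on UNIV g"
    using glip by (rule lipschitz_on_continuous_on)
  \<comment> \<open>Difference quotients are taken over open intervals containing the point, which makes both sets
    \<open>G\<^sub>\<delta>\<close>. The covering estimate for \<open>f\<close> and for its inverse gives
    \<open>q \<bar>E\<bar> \<le> \<bar>f E\<bar> \<le> p \<bar>E\<bar>\<close> on \<open>E \<subseteq> A p \<inter> B q\<close>.\<close>
  define A where "A p = {x. \<forall>d>0. \<exists>c r. 0 < r \<and> r < d \<and> x \<in> ball c r \<and> f (c + r) - f (c - r) \<le> p * (2 * r)}" for p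
  define B where "B q = {x. \<forall>d>0. \<exists>c r. 0 < r \<and> r < d \<and> x \<in> ball c r \<and> q * (2 * r) \<le> f (c + r) - f (c - r)}" for q
  have null: "negligible (A p \<inter> B q \<inter> ball 0 n)" if p: "0 \<le> p" "p < q" for p q n
  proof -
    have q: "q > 0"
      using p by linarith
    define E where "E = A p \<inter> B q \<inter> ball 0 n"
    have E: "E \<in> sets borel"
      unfolding E_def A_def B_def by (intro sets.Int arbitrarily_small_intervals_borel) simp
    have "\<exists>c r. 0 < r \<and> r < d \<and> x \<in> ball c r \<and> f (c + r) - f (c - r) \<le> p * (2 * r)"
      if "x \<in> E" "d > 0" for x d
      using that unfolding E_def A_def by blast
    note fE = emeasure_homeo_image_le[OF mono flip contg gf fg E \<open>0 \<le> p\<close> this]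
    have "emeasure lborel (g ` (f ` E)) \<le> ennreal (1 / q) * emeasure lborel (f ` E)"
    proof (rule emeasure_homeo_image_le(2)[OF gmono glip contf fg gf fE(1)])
      fix y d :: real assume "y \<in> f ` E" and d: "d > 0"
      then obtain x where x: "x \<in> B q" "y = f x"
        by (auto simp: E_def)
      moreover have "d / D > 0"
        using d D by simp
      ultimately obtain c r where cr: "0 < r" "r < d / D" "x \<in> ball c r" "q * (2 * r) \<le> f (c + r) - f (c - r)"
        unfolding B_def by blast
      \<comment> \<open>The image of an interval is an interval, but the image of its centre need
        not be the new centre; centre and radius are recomputed from the image endpoints.\<close>
      let ?u = "f (c - r)" and ?v = "f (c + r)"
      have eqs: "(?u + ?v) / 2 + (?v - ?u) / 2 = ?v" "(?u + ?v) / 2 - (?v - ?u) / 2 = ?u"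
        by (simp_all add: field_simps)
      have 1: "0 < (?v - ?u) / 2" "(?v - ?u) / 2 < d"
        using slope[of "c - r" "c + r"] cr D by (auto simp: field_simps)
      have "?u < y" "y < ?v"
        using cr x by (auto simp: strict_mono_less[OF mono] dist_real_def)
      then have 2: "y \<in> ball ((?u + ?v) / 2) ((?v - ?u) / 2)"
        by (simp add: dist_real_def abs_less_iff field_simps)
      have 3: "g ?v - g ?u \<le> 1 / q * (2 * ((?v - ?u) / 2))"
        using cr q by (simp add: gf field_simps)
      show "\<exists>c r. 0 < r \<and> r < d \<and> y \<in> ball c r \<and> g (c + r) - g (c - r) \<le> 1 / q * (2 * r)"
        using 1 2 3 by (intro exI[of _ "(?u + ?v) / 2"] exI[of _ "(?v - ?u) / 2"]) (simp only: eqs)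
    next
      show "0 \<le> 1 / q"
        using q by simp
    qed
    also have "g ` f ` E = E"
      by (simp add: image_image gf)
    also have "ennreal (1 / q) * emeasure lborel (f ` E) \<le> ennreal (1 / q) * (ennreal p * emeasure lborel E)"
      by (rule mult_left_mono[OF fE(2) zero_le])
    finally have le: "emeasure lborel E \<le> ennreal (1 / q) * (ennreal p * emeasure lborel E)" .
    \<comment> \<open>The ball makes the measure of \<open>E\<close> finite, so that
      \<open>q * m \<le> p * m\<close> with \<open>p < q\<close> forces it to vanish.\<close>
    have "emeasure lborel E \<le> emeasure lborel (ball (0::real) n)"
      by (intro emeasure_mono) (auto simp: E_def)
    then have "emeasure lborel E < \<infinity>"
      using emeasure_bounded_finite[of "ball (0::real) n"] by (simp add: order_le_less_trans)
    then obtain m where m: "emeasure lborel E = ennreal m" "m \<ge> 0"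
      by (cases "emeasure lborel E") auto
    have "m \<le> 1 / q * (p * m)"
      using le m p q by (simp add: ennreal_mult[symmetric] del: times_divide_eq_left)
    then have "q * m \<le> p * m"
      using q by (simp add: field_simps)
    then have "m = 0"
      using p m(2) by (simp add: mult_le_cancel_right)
    then show ?thesis
      using E m unfolding E_def[symmetric] negligible_iff_null_sets
      by (simp add: null_sets_completionI null_setsI)
  qed
  define N where "N = (\<Union>n::nat. \<Union>p\<in>\<rat>. \<Union>q\<in>{q\<in>\<rat>. 0 \<le> p \<and> p < q}. A p \<inter> B q \<inter> ball 0 (real n))"
  have "negligible N"
  proof -
    have "N \<in> null_sets lebesgue"
      unfolding N_def using null countable_rat
      by (intro null_sets_UN null_sets_UN') (auto simp: negligible_iff_null_sets intro: countable_subset[OF _ countable_rat])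
    then show ?thesis
      by (simp add: negligible_iff_null_sets)
  qed
  moreover have "h differentiable (at x)" if x: "x \<notin> N" for x
  proof -
    have xN: "\<not> (x \<in> A p \<and> x \<in> B q)" if "p \<in> \<rat>" "q \<in> \<rat>" "0 \<le> p" "p < q" for p q
    proof -
      obtain n :: nat where "\<bar>x\<bar> < real n"
        using reals_Archimedean2 by blast
      then have "x \<in> ball 0 (real n)"
        by simp
      with x that show ?thesis
        unfolding N_def by blast
    qed
    have A_mono: "x \<in> A p'" if "x \<in> A p" "p \<le> p'" for p p'
      unfolding A_def
    proof (intro CollectI allI impI)
      fix d :: real assume "d > 0"
      then obtain c r where "0 < r" "r < d" "x \<in> ball c r" "f (c + r) - f (c - r) \<le> p * (2 * r)"
        using \<open>x \<in> A p\<close> unfolding A_def by blast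
      moreover have "p * (2 * r) \<le> p' * (2 * r)"
        using that \<open>0 < r\<close> by (intro mult_right_mono) auto
      ultimately show "\<exists>c r. 0 < r \<and> r < d \<and> x \<in> ball c r \<and> f (c + r) - f (c - r) \<le> p' * (2 * r)"
        by (meson order_trans)
    qed
    \<comment> \<open>\<open>l\<close> is the lower derivate of \<open>f\<close> at
      \<open>x\<close>. The covering estimate is for \<open>p \<ge> 0\<close>, hence the condition
      in \<open>P\<close>; a negative \<open>l - e\<close> is handled separately, since
      \<open>f\<close> increases.\<close>
    define P where "P = {p. 0 \<le> p \<and> x \<in> A p}"
    define l where "l = Inf P"
    have bdd: "bdd_below P"
      unfolding P_def by (rule bdd_belowI[of _ 0]) simp
    have "D \<in> P"
      unfolding P_def A_def
    proof (intro CollectI conjI allI impI)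
      fix d :: real assume "d > 0"
      then show "\<exists>c r. 0 < r \<and> r < d \<and> x \<in> ball c r \<and> f (c + r) - f (c - r) \<le> D * (2 * r)"
        using slope(2)[of "x - d/2" "x + d/2"] by (intro exI[of _ x] exI[of _ "d/2"]) auto
    qed (use D in simp)
    then have "P \<noteq> {}" by blast
    have "(f has_real_derivative l) (at x)"
    proof (rule DERIV_of_straddle)
      show "isCont f x"
        using contf by (simp add: continuous_on_eq_continuous_at)
      fix e :: real assume e: "e > 0"
      have center: "x \<in> ball ((u + v) / 2) ((v - u) / 2) \<and> 0 < (v - u) / 2 \<and>
          (u + v) / 2 + (v - u) / 2 = v \<and> (u + v) / 2 - (v - u) / 2 = u" if "u < x" "x < v" for u v
        using that by (auto simp: dist_real_def abs_less_iff field_simps)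
      have "\<exists>d>0. \<forall>u v. u < x \<and> x < v \<and> v - u < d \<longrightarrow> (l - e) * (v - u) \<le> f v - f u"
      proof (cases "l - e \<ge> 0")
        case True
        have "x \<notin> A (l - e)"
        proof
          assume "x \<in> A (l - e)"
          then have "l \<le> l - e"
            unfolding l_def using True bdd by (intro cInf_lower) (auto simp: P_def l_def)
          with e show False by simp
        qed
        then obtain d where d: "d > 0" and dd: "\<And>c r. 0 < r \<Longrightarrow> r < d \<Longrightarrow> x \<in> ball c r \<Longrightarrow>
            (l - e) * (2 * r) < f (c + r) - f (c - r)"
          unfolding A_def by (auto simp: not_le)
        show ?thesis
        proof (intro exI[of _ d] conjI allI impI d)
          fix u v assume "u < x \<and> x < v \<and> v - u < d"
          then show "(l - e) * (v - u) \<le> f v - f u"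
            using dd[of "(v - u) / 2" "(u + v) / 2"] center[of u v] by (auto simp: field_simps)
        qed
      next
        case False
        show ?thesis
        proof (intro exI[of _ 1] conjI allI impI)
          fix u v assume uv: "u < x \<and> x < v \<and> v - u < 1"
          then have "(l - e) * (v - u) \<le> 0"
            using False by (intro mult_nonpos_nonneg) auto
          also have "0 \<le> f v - f u"
            using slope(1)[of u v] uv by simp
          finally show "(l - e) * (v - u) \<le> f v - f u" .
        qed simp
      qed
      then obtain d1 where d1: "d1 > 0" "\<And>u v. u < x \<Longrightarrow> x < v \<Longrightarrow> v - u < d1 \<Longrightarrow> (l - e) * (v - u) \<le> f v - f u"
        by blast
      obtain p where p: "p \<in> P" "p < l + e"
        using cInf_lessD[OF \<open>P \<noteq> {}\<close>, of "l + e"] e by (auto simp: l_def)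
      \<comment> \<open>Two rationals: \<open>p'\<close> lies above an element of \<open>P\<close>,
        so \<open>x \<in> A p'\<close>; then \<open>q\<close> beyond it gives
        \<open>x \<notin> B q\<close>, which bounds the quotients from above.\<close>
      obtain p' where p': "p' \<in> \<rat>" "p < p'" "p' < l + e"
        using Rats_dense_in_real[OF p(2)] by blast
      obtain q where q: "q \<in> \<rat>" "p' < q" "q < l + e"
        using Rats_dense_in_real[OF p'(3)] by blast
      have "x \<in> A p'"
        using A_mono[of p p'] p p' by (simp add: P_def)
      then have "x \<notin> B q"
        using xN[of p' q] p p' q by (auto simp: P_def)
      then obtain d2 where d2: "d2 > 0" and dd2: "\<And>c r. 0 < r \<Longrightarrow> r < d2 \<Longrightarrow> x \<in> ball c r \<Longrightarrow>
            f (c + r) - f (c - r) < q * (2 * r)"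
        unfolding B_def by (auto simp: not_le)
      show "\<exists>d>0. \<forall>u v. u < x \<and> x < v \<and> v - u < d \<longrightarrow> \<bar>f v - f u - l * (v - u)\<bar> \<le> e * (v - u)"
      proof (intro exI[of _ "min d1 d2"] conjI allI impI)
        fix u v assume uv: "u < x \<and> x < v \<and> v - u < min d1 d2"
        then have "f v - f u < q * (v - u)"
          using dd2[of "(v - u) / 2" "(u + v) / 2"] center[of u v] by (auto simp: field_simps)
        also have "q * (v - u) \<le> (l + e) * (v - u)"
          using q uv by (intro mult_right_mono) auto
        finally have "f v - f u \<le> (l + e) * (v - u)" by simp
        moreover have "(l - e) * (v - u) \<le> f v - f u"
          using d1 uv by simp
        ultimately show "\<bar>f v - f u - l * (v - u)\<bar> \<le> e * (v - u)"
          by (simp add: abs_le_iff algebra_simps)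
      qed (use d1 d2 in simp)
    qed
    then have "((\<lambda>x. f x - (C + 1) * x) has_real_derivative l - (C + 1)) (at x)"
      by (auto intro!: derivative_eq_intros)
    then show ?thesis
      by (auto simp: f_def real_differentiable_def)
  qed
  ultimately show thesis
    by (rule that)
qed

section \<open>The fundamental theorem for absolutely continuous curves\<close>

text \<open>The left side is the integral of 1 over \<open>S\<close>. This turns the small measure
  of an open set into the small total length that \<open>abs_cont_on\<close> asks for.\<close>

lemma division_sum_length_le_measure:
  fixes T :: "real set"
  assumes D: "\<D> division_of S" and "S \<subseteq> T" and T: "T \<in> lmeasurable"
  shows "(\<Sum>K\<in>\<D>. Sup K - Inf K) \<le> measure lebesgue T"
proof -
  have "((\<lambda>x. 1::real) has_integral (Sup K - Inf K)) K" if KD: "K \<in> \<D>" for K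
  proof -
    obtain a b where K: "K = {a..b}" "a \<le> b"
      using division_ofD(3,4)[OF D KD] by (metis atLeastatMost_empty_iff box_real(2))
    then show ?thesis
      using has_integral_const_real[of "1::real" a b] by simp
  qed
  from has_integral_combine_division[OF D this]
  have S: "((\<lambda>x. 1::real) has_integral (\<Sum>K\<in>\<D>. Sup K - Inf K)) S"
    by blast
  then have "S \<in> lmeasurable"
    by (metis has_integral_integrable lmeasurable_iff_integrable_on)
  moreover from this have "measure lebesgue S = (\<Sum>K\<in>\<D>. Sup K - Inf K)"
    using S by (simp add: lmeasure_integral integral_unique)
  ultimately show ?thesis
    using measure_mono_fmeasurable[of S T lebesgue] \<open>S \<subseteq> T\<close> T by (simp add: fmeasurableD)
qed

text \<open>The gauge integral suits this: intervals tagged off \<open>N\<close> are controlled by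
  the derivative at the tag, and those tagged in \<open>N\<close> are forced into an open set of
  measure below the \<delta> of absolute continuity, so their increments of \<open>f\<close> add up
  to less than \<open>e / 2\<close>.\<close>

lemma abs_cont_has_integral:
  fixes f :: "real \<Rightarrow> 'a::euclidean_space"
  assumes ac: "abs_cont_on \<alpha> \<beta> f" and "\<alpha> \<le> \<beta>" and N: "negligible N"
    and deriv: "\<And>x. x \<in> {\<alpha>..\<beta>} - N \<Longrightarrow> (f has_vector_derivative f' x) (at x within {\<alpha>..\<beta>})"
  shows "(f' has_integral f \<beta> - f \<alpha>) {\<alpha>..\<beta>}"
proof -
  \<comment> \<open>With value 0 on \<open>N\<close>, an interval tagged in \<open>N\<close>
    contributes only its increment of \<open>f\<close>.\<close>
  define g where "g x = (if x \<in> N then 0 else f' x)" for x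
  have "(g has_integral f \<beta> - f \<alpha>) {\<alpha>..\<beta>}"
    unfolding has_integral_real
  proof (intro allI impI)
    fix e :: real assume e: "e > 0"
    define e' where "e' = e / (2 * (\<beta> - \<alpha> + 1))"
    have e': "e' > 0" "e' * (\<beta> - \<alpha>) < e / 2"
      using e \<open>\<alpha> \<le> \<beta>\<close> by (auto simp: e'_def field_simps)
    obtain \<delta> where \<delta>: "\<delta> > 0" and ac\<delta>: "\<And>\<D> S. \<lbrakk>\<D> division_of S; S \<subseteq> {\<alpha>..\<beta>};
        (\<Sum>K\<in>\<D>. Sup K - Inf K) < \<delta>\<rbrakk> \<Longrightarrow> (\<Sum>K\<in>\<D>. dist (f (Sup K)) (f (Inf K))) < e / 2"
      using ac[unfolded abs_cont_on_def, rule_format, of "e / 2"] e by (metis half_gt_zero)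
    have "N \<in> sets lebesgue"
      using N negligible_imp_measurable by (blast intro: fmeasurableD)
    then obtain U where U: "open U" "N \<subseteq> U" "U - N \<in> lmeasurable" "emeasure lebesgue (U - N) < ennreal \<delta>"
      using sets_lebesgue_outer_open[OF _ \<delta>] by blast
    have Um: "U \<in> lmeasurable" "measure lebesgue U < \<delta>"
    proof -
      have eq: "U = (U - N) \<union> N"
        using U by blast
      show "U \<in> lmeasurable"
        by (subst eq) (use U N negligible_imp_measurable in blast)
      have "measure lebesgue U = measure lebesgue (U - N)"
        using N \<open>U \<in> lmeasurable\<close> by (metis measure_Diff_null_set fmeasurableD negligible_iff_null_sets)
      also have "\<dots> < \<delta>"
        using U(3,4) \<delta> by (simp add: emeasure_eq_measure2 ennreal_less_iff)
      finally show "measure lebesgue U < \<delta>" .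
    qed
    have "\<exists>d>0. (x \<in> N \<longrightarrow> ball x d \<subseteq> U) \<and> (x \<in> {\<alpha>..\<beta>} - N \<longrightarrow>
         (\<forall>y\<in>{\<alpha>..\<beta>}. norm (y - x) < d \<longrightarrow> norm (f y - f x - (y - x) *\<^sub>R f' x) \<le> e' * norm (y - x)))" for x
    proof (cases "x \<in> N")
      case True
      then show ?thesis
        using U open_contains_ball by auto
    next
      case False
      show ?thesis
      proof (cases "x \<in> {\<alpha>..\<beta>}")
        case True
        then show ?thesis
          using deriv[of x] False e'(1)
          unfolding has_vector_derivative_def has_derivative_within_alt by auto
      next
        case out: False
        with False show ?thesis
          by (intro exI[of _ 1]) auto
      qed
    qed
    then obtain d where d: "\<And>x. d x > 0" "\<And>x. x \<in> N \<Longrightarrow> ball x (d x) \<subseteq> U"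
      "\<And>x y. \<lbrakk>x \<in> {\<alpha>..\<beta>} - N; y \<in> {\<alpha>..\<beta>}; norm (y - x) < d x\<rbrakk>
         \<Longrightarrow> norm (f y - f x - (y - x) *\<^sub>R f' x) \<le> e' * norm (y - x)"
      by metis
    show "\<exists>\<gamma>. gauge \<gamma> \<and> (\<forall>\<D>. \<D> tagged_division_of {\<alpha>..\<beta>} \<and> \<gamma> fine \<D> \<longrightarrow>
        norm ((\<Sum>(x, k)\<in>\<D>. measure lborel k *\<^sub>R g x) - (f \<beta> - f \<alpha>)) < e)"
    proof (intro exI[of _ "\<lambda>x. ball x (d x)"] conjI allI impI)
      show "gauge (\<lambda>x. ball x (d x))"
        using d(1) gauge_ball_dependent by blast
      fix p assume p: "p tagged_division_of {\<alpha>..\<beta>} \<and> (\<lambda>x. ball x (d x)) fine p"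
      then have ptag: "p tagged_division_of {\<alpha>..\<beta>}" and fine: "(\<lambda>x. ball x (d x)) fine p"
        by auto
      note pD = tagged_division_ofD[OF ptag]
      have interval: "\<exists>u v. K = {u..v} \<and> u \<le> x \<and> x \<le> v \<and> \<alpha> \<le> u \<and> v \<le> \<beta> \<and> {u..v} \<subseteq> ball x (d x)"
        if xK: "(x, K) \<in> p" for x K
      proof -
        obtain u v where K: "K = {u..v}"
          using pD(4)[OF xK] by auto
        moreover have "u \<le> x" "x \<le> v"
          using pD(2)[OF xK] K by auto
        moreover have "\<alpha> \<le> u" "v \<le> \<beta>"
          using pD(3)[OF xK] calculation by auto
        ultimately show ?thesis
          using fineD[OF fine xK] by blast
      qed
      define P where "P = {xK \<in> p. fst xK \<in> N}"
      define F where "F = (\<lambda>(x, K). measure lborel K *\<^sub>R g x - (f (Sup K) - f (Inf K)))"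
      have Ppart: "P tagged_partial_division_of {\<alpha>..\<beta>}"
        using ptag by (auto simp: P_def tagged_division_of_def intro: tagged_partial_division_subset)
      have Pdiv: "snd ` P division_of \<Union>(snd ` P)"
        by (rule partial_division_of_tagged_division[OF Ppart])
      have PU: "\<Union>(snd ` P) \<subseteq> U"
        using d(2) interval by (fastforce simp: P_def)
      have "\<Union>(snd ` P) \<subseteq> {\<alpha>..\<beta>}"
        using pD(3) by (force simp: P_def)
      then have small: "(\<Sum>K\<in>snd ` P. dist (f (Sup K)) (f (Inf K))) < e / 2"
        using division_sum_length_le_measure[OF Pdiv PU Um(1)] Um(2) by (intro ac\<delta>[OF Pdiv]) auto
      \<comment> \<open>\<open>Sup\<close> and \<open>Inf\<close> of the empty set are unspecified,
        and the passage from tagged intervals to the set of intervals needs the value 0 on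
        degenerate ones.\<close>
      define D where "D K = (if K = {} then 0 else dist (f (Sup K)) (f (Inf K)))" for K
      have nonempty: "K \<noteq> {}" if "(x, K) \<in> p" for x K
        using pD(2)[OF that] by auto
      have "norm (\<Sum>xK\<in>P. F xK) \<le> (\<Sum>xK\<in>P. (\<lambda>(x, K). D K) xK)"
        by (rule sum_norm_le)
          (auto simp: F_def P_def g_def D_def dist_norm norm_minus_commute dest: nonempty)
      also have "\<dots> = (\<Sum>K\<in>snd ` P. D K)"
      proof (rule sum.over_tagged_division_lemma[OF tagged_partial_division_of_Union_self[OF Ppart]])
        show "D (cbox u v) = 0" if "box u v = {}" for u v
          using that by (cases "u = v") (auto simp: D_def)
      qed
      also have "\<dots> \<le> (\<Sum>K\<in>snd ` P. dist (f (Sup K)) (f (Inf K)))"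
        by (intro sum_mono) (simp add: D_def)
      finally have sumP: "norm (\<Sum>xK\<in>P. F xK) < e / 2"
        using small by simp
      have len: "\<beta> - \<alpha> = (\<Sum>(x, K)\<in>p. Sup K - Inf K)" "f \<beta> - f \<alpha> = (\<Sum>(x, K)\<in>p. f (Sup K) - f (Inf K))"
        using additive_tagged_division_1[where f = "\<lambda>x. x"] additive_tagged_division_1[where f = f]
          \<open>\<alpha> \<le> \<beta>\<close> ptag by auto
      have "norm (\<Sum>xK\<in>p - P. F xK) \<le> (\<Sum>xK\<in>p - P. e' * (\<lambda>(x, K). Sup K - Inf K) xK)"
      proof (rule sum_norm_le, clarify)
        fix x K assume xK: "(x, K) \<in> p" "(x, K) \<notin> P"
        then have xN: "x \<notin> N"
          by (simp add: P_def)
        obtain u v where K: "K = {u..v}" "u \<le> x" "x \<le> v" "\<alpha> \<le> u" "v \<le> \<beta>" "{u..v} \<subseteq> ball x (d x)"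
          using interval[OF xK(1)] by blast
        then have "u \<in> ball x (d x)" "v \<in> ball x (d x)"
          by (meson atLeastAtMost_iff order_refl order_trans subsetD)+
        then have ball: "norm (u - x) < d x" "norm (v - x) < d x"
          by (auto simp: dist_norm norm_minus_commute)
        have "norm (F (x, K)) = norm ((f u - f x - (u - x) *\<^sub>R f' x) - (f v - f x - (v - x) *\<^sub>R f' x))"
          using K xN by (simp add: F_def g_def algebra_simps)
        also have "\<dots> \<le> norm (f u - f x - (u - x) *\<^sub>R f' x) + norm (f v - f x - (v - x) *\<^sub>R f' x)"
          by (rule norm_triangle_ineq4)
        also have "\<dots> \<le> e' * norm (u - x) + e' * norm (v - x)"
          using K xN ball by (intro add_mono d(3)) auto
        also have "\<dots> = e' * (v - u)"
          using K by (simp add: algebra_simps)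
        finally show "norm (F (x, K)) \<le> e' * (Sup K - Inf K)"
          using K by simp
      qed
      also have "\<dots> \<le> (\<Sum>xK\<in>p. e' * (\<lambda>(x, K). Sup K - Inf K) xK)"
      proof (rule sum_mono2)
        fix b assume "b \<in> p - (p - P)"
        then show "0 \<le> e' * (\<lambda>(x, K). Sup K - Inf K) b"
          using interval[of "fst b" "snd b"] e'(1) by (auto simp: case_prod_beta intro!: mult_nonneg_nonneg)
      qed (use pD in auto)
      also have "\<dots> = e' * (\<beta> - \<alpha>)"
        by (simp add: len(1) sum_distrib_left)
      finally have sumQ: "norm (\<Sum>xK\<in>p - P. F xK) < e / 2"
        using e'(2) by simp
      have "(\<Sum>(x, k)\<in>p. measure lborel k *\<^sub>R g x) - (f \<beta> - f \<alpha>) = (\<Sum>xK\<in>p. F xK)"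
        unfolding len(2) sum_subtractf[symmetric] F_def by (intro sum.cong) auto
      also have "\<dots> = (\<Sum>xK\<in>p - P. F xK) + (\<Sum>xK\<in>P. F xK)"
        using pD(1) by (intro sum.subset_diff) (auto simp: P_def)
      also have "norm \<dots> < e"
        using norm_triangle_ineq[of "\<Sum>xK\<in>p - P. F xK" "\<Sum>xK\<in>P. F xK"] sumP sumQ by linarith
      finally show "norm ((\<Sum>(x, k)\<in>p. measure lborel k *\<^sub>R g x) - (f \<beta> - f \<alpha>)) < e" .
    qed
  qed
  then show ?thesis
    by (rule has_integral_spike[OF N, rotated]) (simp add: g_def)
qed

lemma abs_cont_on_subset:
  assumes "abs_cont_on \<alpha> \<beta> f" "\<alpha> \<le> u" "v \<le> \<beta>"
  shows "abs_cont_on u v f"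
proof -
  have "{u..v} \<subseteq> {\<alpha>..\<beta>}"
    using assms by auto
  then show ?thesis
    using assms(1) unfolding abs_cont_on_def by (meson order_trans)
qed

text \<open>A function whose indefinite integral has bounded variation is absolutely integrable.
  Absolute continuity bounds the variation by 1 on intervals shorter than \<delta>, and finitely
  many of these make up the whole interval.\<close>

lemma abs_cont_absolutely_integrable:
  fixes f :: "real \<Rightarrow> 'a::euclidean_space"
  assumes ac: "abs_cont_on \<alpha> \<beta> f" and "\<alpha> \<le> \<beta>" and N: "negligible N"
    and deriv: "\<And>x. x \<in> {\<alpha>..\<beta>} - N \<Longrightarrow> (f has_vector_derivative f' x) (at x within {\<alpha>..\<beta>})"
  shows "f' absolutely_integrable_on {\<alpha>..\<beta>}"
proof -
  obtain \<delta> where \<delta>: "\<delta> > 0" and ac\<delta>: "\<And>\<D> S. \<lbrakk>\<D> division_of S; S \<subseteq> {\<alpha>..\<beta>};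
      (\<Sum>K\<in>\<D>. Sup K - Inf K) < \<delta>\<rbrakk> \<Longrightarrow> (\<Sum>K\<in>\<D>. dist (f (Sup K)) (f (Inf K))) < 1"
    using ac[unfolded abs_cont_on_def, rule_format, of 1] by (metis zero_less_one)
  have int: "(f' has_integral f v - f u) {u..v}" if "\<alpha> \<le> u" "u \<le> v" "v \<le> \<beta>" for u v
  proof (rule abs_cont_has_integral[OF abs_cont_on_subset[OF ac] _ N])
    fix x assume "x \<in> {u..v} - N"
    then show "(f has_vector_derivative f' x) (at x within {u..v})"
      using that by (intro has_vector_derivative_within_subset[OF deriv]) auto
  qed (use that in auto)
  have short: "f' absolutely_integrable_on {u..v}" if uv: "\<alpha> \<le> u" "u \<le> v" "v \<le> \<beta>" "v - u < \<delta>" for u v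
    unfolding box_real(2)[symmetric]
  proof (rule bounded_variation_absolutely_integrable_interval)
    show "f' integrable_on cbox u v"
      using int[OF uv(1-3)] by auto
    fix \<D> assume D: "\<D> division_of cbox u v"
    have "(\<Sum>K\<in>\<D>. norm (integral K f')) = (\<Sum>K\<in>\<D>. dist (f (Sup K)) (f (Inf K)))"
    proof (rule sum.cong)
      fix K assume K: "K \<in> \<D>"
      obtain a b where ab: "K = {a..b}" "a \<le> b"
        using division_ofD(3,4)[OF D K] by (metis atLeastatMost_empty_iff box_real(2))
      then have "u \<le> a" "b \<le> v"
        using division_ofD(2)[OF D K] by auto
      then show "norm (integral K f') = dist (f (Sup K)) (f (Inf K))"
        using ab uv integral_unique[OF int[of a b]] by (simp add: dist_norm)
    qed simp
    also have "\<dots> < 1"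
    proof (rule ac\<delta>[OF D])
      show "(\<Sum>K\<in>\<D>. Sup K - Inf K) < \<delta>"
        using division_sum_length_le_measure[OF D order_refl] uv by simp
    qed (use uv in auto)
    finally show "(\<Sum>K\<in>\<D>. norm (integral K f')) \<le> 1"
      by simp
  qed
  \<comment> \<open>Steps of \<delta> / 2 keep each piece strictly shorter than \<delta>; the
    minimum with \<beta> cuts off the last one.\<close>
  have "f' absolutely_integrable_on {\<alpha>..min \<beta> (\<alpha> + real n * (\<delta> / 2))}" for n
  proof (induction n)
    case 0
    show ?case
      using short[of \<alpha> \<alpha>] \<open>\<alpha> \<le> \<beta>\<close> \<delta> by simp
  next
    case (Suc n)
    define t where "t = \<alpha> + real n * (\<delta> / 2)"
    have step: "\<alpha> + real (Suc n) * (\<delta> / 2) = t + \<delta> / 2" "\<alpha> \<le> t"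
      using \<delta> by (simp_all add: t_def field_simps)
    have bounds: "\<alpha> \<le> min \<beta> t" "min \<beta> t \<le> min \<beta> (t + \<delta> / 2)"
        "min \<beta> (t + \<delta> / 2) \<le> \<beta>" "min \<beta> (t + \<delta> / 2) - min \<beta> t < \<delta>"
      using step(2) \<open>\<alpha> \<le> \<beta>\<close> \<delta> by (auto simp: min_def)
    show ?case
      unfolding step(1)
      using Suc short[OF bounds] bounds(1,2) unfolding t_def[symmetric]
      by (rule absolutely_integrable_on_combine)
  qed
  moreover obtain n where "\<beta> - \<alpha> < real n * (\<delta> / 2)"
    using reals_Archimedean3[OF half_gt_zero[OF \<delta>]] by blast
  then have "min \<beta> (\<alpha> + real n * (\<delta> / 2)) = \<beta>"
    by simp
  ultimately show ?thesis
    by metis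
qed

section \<open>Length of horizontal curves and the control distance\<close>

definition hproj :: "heis \<Rightarrow> real \<times> real" where
  "hproj P = (fst P, fst (snd P))"

text \<open>The third coordinate of \<open>P\<inverse> \<cdot> Q\<close>.\<close>

definition vert :: "heis \<Rightarrow> heis \<Rightarrow> real" where
  "vert P Q = snd (snd Q) - snd (snd P) - 2 * (fst Q * fst (snd P) - fst P * fst (snd Q))"

text \<open>The horizontal vector at \<open>P\<close> above a given planar velocity, in closed form
  so that horizontality becomes a polynomial identity.\<close>

definition horiz :: "heis \<Rightarrow> real \<Rightarrow> real \<Rightarrow> heis" where
  "horiz P a b = (a, b, 2 * (a * fst (snd P) - b * fst P))"

lemma horizontal_field_eq: "a *\<^sub>R fieldX P + b *\<^sub>R fieldY P = horiz P a b"
  by (simp add: horiz_def fieldX_def fieldY_def case_prod_beta algebra_simps)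

lemma bounded_linear_horizontal_part: "bounded_linear (\<lambda>v::heis. (fst v, fst (snd v)))"
  by (intro bounded_linear_Pair bounded_linear_fst bounded_linear_compose[OF bounded_linear_fst bounded_linear_snd])

text \<open>Both bounds come from integrating along the curve. Measured from the starting point,
  \<open>vert\<close> has as derivative twice the symplectic product of planar velocity and planar
  displacement; the displacement never exceeds the length \<open>l\<close>, so the integral is at
  most 2 l times l.\<close>

lemma horizontal_curve_bounds:
  assumes "\<alpha> < \<beta>" and curve: "horizontal_curve \<alpha> \<beta> \<gamma> a b"
  shows "norm (hproj (\<gamma> \<beta>) - hproj (\<gamma> \<alpha>)) \<le> horizontal_length \<alpha> \<beta> a b"
    and "\<bar>vert (\<gamma> \<alpha>) (\<gamma> \<beta>)\<bar> \<le> 2 * (horizontal_length \<alpha> \<beta> a b)\<^sup>2"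
proof -
  define l where "l = horizontal_length \<alpha> \<beta> a b"
  define F where "F s = horiz (\<gamma> s) (a s) (b s)" for s
  have ac: "abs_cont_on \<alpha> \<beta> \<gamma>"
    using curve by (simp add: horizontal_curve_def)
  have "AE s in lebesgue_on {\<alpha>..\<beta>}. (\<gamma> has_vector_derivative F s) (at s within {\<alpha>..\<beta>})"
    using curve by (simp add: horizontal_curve_def horizontal_field_eq F_def)
  then have "AE s in lebesgue. s \<in> {\<alpha>..\<beta>} \<longrightarrow> (\<gamma> has_vector_derivative F s) (at s within {\<alpha>..\<beta>})"
    by (subst (asm) AE_restrict_space_iff) auto
  then obtain N where N: "N \<in> null_sets lebesgue"
      "{s \<in> space lebesgue. \<not> (s \<in> {\<alpha>..\<beta>} \<longrightarrow> (\<gamma> has_vector_derivative F s) (at s within {\<alpha>..\<beta>}))} \<subseteq> N"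
    by (auto simp: eventually_ae_filter)
  have neg: "negligible N"
    using N by (simp add: negligible_iff_null_sets)
  have deriv: "(\<gamma> has_vector_derivative F s) (at s within {\<alpha>..\<beta>})" if "s \<in> {\<alpha>..\<beta>} - N" for s
    using N(2) that by auto
  have int: "(F has_integral \<gamma> s - \<gamma> \<alpha>) {\<alpha>..s}" if "s \<in> {\<alpha>..\<beta>}" for s
  proof (rule abs_cont_has_integral[OF abs_cont_on_subset[OF ac] _ neg])
    fix x assume "x \<in> {\<alpha>..s} - N"
    then show "(\<gamma> has_vector_derivative F x) (at x within {\<alpha>..s})"
      using that by (intro has_vector_derivative_within_subset[OF deriv]) auto
  qed (use that in auto)
  have F_ai: "F absolutely_integrable_on {\<alpha>..\<beta>}"
    using abs_cont_absolutely_integrable[OF ac _ neg deriv] \<open>\<alpha> < \<beta>\<close> by simp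
  define G where "G s = (a s, b s)" for s
  have GF: "G = (\<lambda>v. (fst v, fst (snd v))) \<circ> F"
    by (auto simp: G_def F_def horiz_def)
  note lin = bounded_linear_horizontal_part
  have G_ai: "G absolutely_integrable_on {\<alpha>..\<beta>}"
    unfolding GF by (rule absolutely_integrable_linear[OF F_ai lin])
  have G_int: "(G has_integral hproj (\<gamma> s) - hproj (\<gamma> \<alpha>)) {\<alpha>..s}" if "s \<in> {\<alpha>..\<beta>}" for s
    using has_integral_linear[OF int[OF that] lin] by (simp add: GF hproj_def)
  have nG_ai: "(\<lambda>s. norm (G s)) absolutely_integrable_on {\<alpha>..\<beta>}"
    by (rule absolutely_integrable_norm[OF G_ai, unfolded o_def])
  have l: "l = integral {\<alpha>..\<beta>} (\<lambda>s. norm (G s))"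
    using set_lebesgue_integral_eq_integral(2)[OF nG_ai]
    by (simp add: l_def horizontal_length_def G_def norm_Pair)
  have nG_int: "(\<lambda>s. norm (G s)) integrable_on {\<alpha>..\<beta>}"
    using nG_ai by (rule set_lebesgue_integral_eq_integral(1))
  have part: "norm (hproj (\<gamma> s) - hproj (\<gamma> \<alpha>)) \<le> l" if "s \<in> {\<alpha>..\<beta>}" for s
  proof -
    have sub: "(\<lambda>s. norm (G s)) integrable_on {\<alpha>..s}"
      using nG_int that by (auto intro: integrable_subinterval_real)
    have "norm (integral {\<alpha>..s} G) \<le> integral {\<alpha>..s} (\<lambda>s. norm (G s))"
      using G_int[OF that] sub by (intro integral_norm_bound_integral) auto
    also have "\<dots> \<le> l"
      unfolding l using nG_int sub that by (intro integral_subset_le) auto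
    finally show ?thesis
      using G_int[OF that] by (simp add: integral_unique)
  qed
  then show "norm (hproj (\<gamma> \<beta>) - hproj (\<gamma> \<alpha>)) \<le> horizontal_length \<alpha> \<beta> a b"
    using \<open>\<alpha> < \<beta>\<close> by (simp add: l_def)
  define x0 y0 where "x0 = fst (\<gamma> \<alpha>)" and "y0 = fst (snd (\<gamma> \<alpha>))"
  define H where "H s = 2 * (a s * (fst (snd (\<gamma> s)) - y0) - b s * (fst (\<gamma> s) - x0))" for s
  \<comment> \<open>Up to a constant this functional is \<open>vert (\<gamma> \<alpha>)\<close>;
    applied to the derivative of the curve it gives \<open>H\<close>.\<close>
  have linH: "bounded_linear (\<lambda>v::heis. snd (snd v) - 2 * (fst v * y0 - fst (snd v) * x0))"
    by (intro bounded_linear_sub bounded_linear_const_mult bounded_linear_mult_const bounded_linear_fst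
        bounded_linear_compose[OF bounded_linear_fst bounded_linear_snd]
        bounded_linear_compose[OF bounded_linear_snd bounded_linear_snd])
  have "(H has_integral vert (\<gamma> \<alpha>) (\<gamma> \<beta>)) {\<alpha>..\<beta>}"
  proof -
    have "(\<lambda>v. snd (snd v) - 2 * (fst v * y0 - fst (snd v) * x0)) \<circ> F = H"
      by (auto simp: H_def F_def horiz_def algebra_simps)
    moreover have "snd (snd (\<gamma> \<beta> - \<gamma> \<alpha>)) - 2 * (fst (\<gamma> \<beta> - \<gamma> \<alpha>) * y0 - fst (snd (\<gamma> \<beta> - \<gamma> \<alpha>)) * x0)
        = vert (\<gamma> \<alpha>) (\<gamma> \<beta>)"
      by (simp add: vert_def x0_def y0_def algebra_simps)
    ultimately show ?thesis
      using has_integral_linear[OF int linH, of \<beta>] \<open>\<alpha> < \<beta>\<close> by simp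
  qed
  then have "norm (vert (\<gamma> \<alpha>) (\<gamma> \<beta>)) \<le> integral {\<alpha>..\<beta>} (\<lambda>s. (2 * l) * norm (G s))"
    unfolding integral_unique[symmetric]
  proof (intro order_trans[OF _ integral_norm_bound_integral[of H]])
    show "H integrable_on {\<alpha>..\<beta>}"
      using \<open>(H has_integral _) _\<close> by blast
    show "(\<lambda>s. (2 * l) * norm (G s)) integrable_on {\<alpha>..\<beta>}"
      using nG_int by (rule integrable_on_mult_right)
    show "norm (H s) \<le> (2 * l) * norm (G s)" if "s \<in> {\<alpha>..\<beta>}" for s
    proof -
      let ?w = "hproj (\<gamma> s) - hproj (\<gamma> \<alpha>)"
      \<comment> \<open>Rotating the displacement by a right angle turns the symplectic product into
        an inner product, ready for Cauchy-Schwarz.\<close>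
      have "H s = 2 * ((snd ?w, - fst ?w) \<bullet> G s)"
        by (simp add: H_def G_def hproj_def x0_def y0_def algebra_simps)
      also have "norm \<dots> \<le> 2 * (norm (snd ?w, - fst ?w) * norm (G s))"
        using Cauchy_Schwarz_ineq2[of "(snd ?w, - fst ?w)" "G s"] by simp
      also have "norm (snd ?w, - fst ?w) = norm ?w"
        by (simp add: norm_Pair norm_prod_def add.commute power2_commute)
      finally show ?thesis
        using mult_right_mono[OF part[OF that], of "norm (G s)"] by simp
    qed
  qed (simp add: integral_unique)
  also have "\<dots> = 2 * l\<^sup>2"
    by (simp add: l power2_eq_square)
  finally show "\<bar>vert (\<gamma> \<alpha>) (\<gamma> \<beta>)\<bar> \<le> 2 * (horizontal_length \<alpha> \<beta> a b)\<^sup>2"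
    by (simp add: l_def)
qed

section \<open>Lipschitz paths of speed at most 1, and explicit examples\<close>

lemma lipschitz_imp_abs_cont_on:
  fixes f :: "real \<Rightarrow> 'a::metric_space"
  assumes "C-lipschitz_on {\<alpha>..\<beta>} f"
  shows "abs_cont_on \<alpha> \<beta> f"
  unfolding abs_cont_on_def
proof (intro allI impI)
  fix e :: real assume e: "e > 0"
  have C: "C \<ge> 0"
    using assms by (rule lipschitz_on_nonneg)
  show "\<exists>\<delta>>0. \<forall>\<D> S. \<D> division_of S \<and> S \<subseteq> {\<alpha>..\<beta>} \<and> (\<Sum>K\<in>\<D>. Sup K - Inf K) < \<delta> \<longrightarrow>
      (\<Sum>K\<in>\<D>. dist (f (Sup K)) (f (Inf K))) < e"
  proof (intro exI[of _ "e / (C + 1)"] conjI allI impI)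
    fix \<D> S assume *: "\<D> division_of S \<and> S \<subseteq> {\<alpha>..\<beta>} \<and> (\<Sum>K\<in>\<D>. Sup K - Inf K) < e / (C + 1)"
    have "(\<Sum>K\<in>\<D>. dist (f (Sup K)) (f (Inf K))) \<le> (\<Sum>K\<in>\<D>. (C + 1) * (Sup K - Inf K))"
    proof (rule sum_mono)
      fix K assume K: "K \<in> \<D>"
      obtain a b where ab: "K = {a..b}" "a \<le> b"
        using division_ofD(3,4)[OF conjunct1[OF *] K] by (metis atLeastatMost_empty_iff box_real(2))
      have "K \<subseteq> {\<alpha>..\<beta>}"
        using division_ofD(2)[OF conjunct1[OF *] K] * by blast
      then have "a \<in> {\<alpha>..\<beta>}" "b \<in> {\<alpha>..\<beta>}"
        using ab by auto
      then have "dist (f b) (f a) \<le> C * (b - a)"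
        using lipschitz_onD[OF assms, of b a] ab by (simp add: dist_real_def)
      also have "\<dots> \<le> (C + 1) * (b - a)"
        using ab by (intro mult_right_mono) auto
      finally show "dist (f (Sup K)) (f (Inf K)) \<le> (C + 1) * (Sup K - Inf K)"
        using ab by simp
    qed
    also have "\<dots> = (C + 1) * (\<Sum>K\<in>\<D>. Sup K - Inf K)"
      by (simp add: sum_distrib_left)
    also have "\<dots> < e"
      using * C by (simp add: field_simps)
    finally show "(\<Sum>K\<in>\<D>. dist (f (Sup K)) (f (Inf K))) < e" .
  qed (use e C in simp)
qed

text \<open>
  Connectability by a Lipschitz horizontal curve of speed at most 1 in time \<open>T\<close>. Unlike absolute
  continuity, the Lipschitz condition passes trivially to concatenations.
\<close>

definition reach :: "heis \<Rightarrow> heis \<Rightarrow> real \<Rightarrow> bool" where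
  "reach P Q T \<longleftrightarrow> T \<ge> 0 \<and> (\<exists>\<gamma> N C. negligible N \<and> C-lipschitz_on {0..T} \<gamma> \<and> \<gamma> 0 = P \<and> \<gamma> T = Q \<and>
     (\<forall>s\<in>{0<..<T} - N. \<exists>a b. a\<^sup>2 + b\<^sup>2 \<le> 1 \<and> (\<gamma> has_vector_derivative horiz (\<gamma> s) a b) (at s)))"

lemma reachI:
  assumes "T \<ge> 0" "negligible N" "C-lipschitz_on {0..T} \<gamma>" "\<gamma> 0 = P" "\<gamma> T = Q"
    "\<And>s. s \<in> {0<..<T} - N \<Longrightarrow> \<exists>a b. a\<^sup>2 + b\<^sup>2 \<le> 1 \<and> (\<gamma> has_vector_derivative horiz (\<gamma> s) a b) (at s)"
  shows "reach P Q T"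
  using assms unfolding reach_def by blast

lemma reach_trans:
  assumes "reach P Q T" "reach Q R U"
  shows "reach P R (T + U)"
proof -
  obtain \<gamma>1 N1 C1 where 1: "T \<ge> 0" "negligible N1" "C1-lipschitz_on {0..T} \<gamma>1" "\<gamma>1 0 = P" "\<gamma>1 T = Q"
    "\<And>s. s \<in> {0<..<T} - N1 \<Longrightarrow> \<exists>a b. a\<^sup>2 + b\<^sup>2 \<le> 1 \<and> (\<gamma>1 has_vector_derivative horiz (\<gamma>1 s) a b) (at s)"
    using assms(1) unfolding reach_def by blast
  obtain \<gamma>2 N2 C2 where 2: "U \<ge> 0" "negligible N2" "C2-lipschitz_on {0..U} \<gamma>2" "\<gamma>2 0 = Q" "\<gamma>2 U = R"
    "\<And>s. s \<in> {0<..<U} - N2 \<Longrightarrow> \<exists>a b. a\<^sup>2 + b\<^sup>2 \<le> 1 \<and> (\<gamma>2 has_vector_derivative horiz (\<gamma>2 s) a b) (at s)"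
    using assms(2) unfolding reach_def by blast
  define g where "g s = \<gamma>2 (s - T)" for s
  define \<gamma> where "\<gamma> s = (if s \<le> T then \<gamma>1 s else g s)" for s
  define C where "C = max C1 C2"
  have "C-lipschitz_on {0..T + U} \<gamma>"
    unfolding \<gamma>_def
  proof (rule lipschitz_on_concat)
    show "C-lipschitz_on {0..T} \<gamma>1"
      using 1(3) by (rule lipschitz_on_mono) (auto simp: C_def)
    show "C-lipschitz_on {T..T + U} g"
    proof (rule lipschitz_onI)
      fix x y assume "x \<in> {T..T + U}" "y \<in> {T..T + U}"
      then have "dist (g x) (g y) \<le> C2 * dist (x - T) (y - T)"
        unfolding g_def by (intro lipschitz_onD[OF 2(3)]) auto
      also have "\<dots> \<le> C * dist x y"
        unfolding C_def dist_real_def by (simp add: mult_right_mono)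
      finally show "dist (g x) (g y) \<le> C * dist x y" .
    qed (use lipschitz_on_nonneg[OF 1(3)] in \<open>simp add: C_def\<close>)
    show "\<gamma>1 T = g T"
      using 1 2 by (simp add: g_def)
  qed
  \<comment> \<open>The concatenation may have a corner at \<open>T\<close>, so \<open>T\<close>
    joins the exceptional set.\<close>
  moreover have "negligible (insert T (N1 \<union> (+) T ` N2))"
    using 1(2) 2(2) by (simp add: negligible_translation)
  moreover have "\<exists>a b. a\<^sup>2 + b\<^sup>2 \<le> 1 \<and> (\<gamma> has_vector_derivative horiz (\<gamma> s) a b) (at s)"
    if s: "s \<in> {0<..<T + U} - insert T (N1 \<union> (+) T ` N2)" for s
  proof (cases "s < T")
    case True
    then obtain a b where ab: "a\<^sup>2 + b\<^sup>2 \<le> 1" "(\<gamma>1 has_vector_derivative horiz (\<gamma>1 s) a b) (at s)"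
      using 1(6)[of s] s by auto
    have "(\<gamma> has_vector_derivative horiz (\<gamma>1 s) a b) (at s)"
      by (rule has_vector_derivative_transform_within_open[OF ab(2), of "{..<T}"])
        (use True in \<open>auto simp: \<gamma>_def\<close>)
    then show ?thesis
      using ab True by (auto simp: \<gamma>_def)
  next
    case False
    then have sT: "T < s"
      using s by auto
    have "s - T \<notin> N2"
      using s by (metis Diff_iff UnI2 add.commute diff_add_cancel image_eqI insertCI)
    then obtain a b where ab: "a\<^sup>2 + b\<^sup>2 \<le> 1"
        "(\<gamma>2 has_vector_derivative horiz (\<gamma>2 (s - T)) a b) (at (s - T))"
      using 2(6)[of "s - T"] s sT by auto
    have "((\<lambda>s. s - T) has_vector_derivative 1) (at s)"
      by (auto intro!: derivative_eq_intros)
    from vector_diff_chain_at[OF this ab(2)]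
    have "(g has_vector_derivative horiz (g s) a b) (at s)"
      by (simp add: o_def g_def[abs_def])
    then have "(\<gamma> has_vector_derivative horiz (g s) a b) (at s)"
      by (rule has_vector_derivative_transform_within_open[of _ _ _ "{T<..}"])
        (use sT in \<open>auto simp: \<gamma>_def\<close>)
    then show ?thesis
      using ab sT by (auto simp: \<gamma>_def)
  qed
  moreover have "\<gamma> 0 = P" "\<gamma> (T + U) = R"
    using 1(1,4,5) 2(1,4,5) by (auto simp: \<gamma>_def g_def)
  ultimately show ?thesis
    using 1(1) 2(1) by (intro reachI[of _ "insert T (N1 \<union> (+) T ` N2)" C \<gamma>]) auto
qed

text \<open>Left translation is affine, and its linear part \<open>A\<close> carries the horizontal
  vector with coefficients \<open>a\<close>, \<open>b\<close> at a point to the one with the same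
  coefficients at the image, so the speed is unchanged.\<close>

lemma reach_translate:
  assumes "reach P Q T"
  shows "reach (heis_mult g P) (heis_mult g Q) T"
proof -
  obtain \<gamma> N C where \<gamma>: "T \<ge> 0" "negligible N" "C-lipschitz_on {0..T} \<gamma>" "\<gamma> 0 = P" "\<gamma> T = Q"
    "\<And>s. s \<in> {0<..<T} - N \<Longrightarrow> \<exists>a b. a\<^sup>2 + b\<^sup>2 \<le> 1 \<and> (\<gamma> has_vector_derivative horiz (\<gamma> s) a b) (at s)"
    using assms unfolding reach_def by blast
  define A :: "heis \<Rightarrow> heis"
    where "A v = (fst v, fst (snd v), snd (snd v) + 2 * (fst v * fst (snd g) - fst g * fst (snd v)))" for v
  have mult: "heis_mult g v = g + A v" for v
    by (simp add: heis_mult_def A_def case_prod_beta prod_eq_iff)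
  have lin: "bounded_linear A"
    unfolding A_def
    by (intro bounded_linear_Pair bounded_linear_add bounded_linear_sub bounded_linear_const_mult
        bounded_linear_mult_const bounded_linear_fst
        bounded_linear_compose[OF bounded_linear_fst bounded_linear_snd]
        bounded_linear_compose[OF bounded_linear_snd bounded_linear_snd])
  obtain B where B: "B \<ge> 0" "\<And>v. norm (A v) \<le> norm v * B"
    using bounded_linear.nonneg_bounded[OF lin] by blast
  show ?thesis
  proof (rule reachI[OF \<gamma>(1,2)])
    show "(C * B)-lipschitz_on {0..T} (\<lambda>s. heis_mult g (\<gamma> s))"
    proof (rule lipschitz_onI)
      fix x y assume xy: "x \<in> {0..T}" "y \<in> {0..T}"
      have "dist (heis_mult g (\<gamma> x)) (heis_mult g (\<gamma> y)) = norm (A (\<gamma> x - \<gamma> y))"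
        by (simp add: mult dist_norm linear_diff[OF bounded_linear.linear[OF lin]])
      also have "\<dots> \<le> dist (\<gamma> x) (\<gamma> y) * B"
        using B(2) by (simp add: dist_norm)
      also have "\<dots> \<le> C * dist x y * B"
        using lipschitz_onD[OF \<gamma>(3) xy] B(1) by (intro mult_right_mono)
      finally show "dist (heis_mult g (\<gamma> x)) (heis_mult g (\<gamma> y)) \<le> C * B * dist x y"
        by (simp add: mult_ac)
    qed (use lipschitz_on_nonneg[OF \<gamma>(3)] B in simp)
    fix s assume "s \<in> {0<..<T} - N"
    then obtain a b where ab: "a\<^sup>2 + b\<^sup>2 \<le> 1" "(\<gamma> has_vector_derivative horiz (\<gamma> s) a b) (at s)"
      using \<gamma>(6) by blast
    have "((\<lambda>s. g + A (\<gamma> s)) has_vector_derivative 0 + A (horiz (\<gamma> s) a b)) (at s)"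
      by (intro has_vector_derivative_add has_vector_derivative_const
          bounded_linear.has_vector_derivative[OF lin ab(2)])
    moreover have "A (horiz (\<gamma> s) a b) = horiz (heis_mult g (\<gamma> s)) a b"
      by (simp add: mult A_def horiz_def algebra_simps)
    ultimately show "\<exists>a b. a\<^sup>2 + b\<^sup>2 \<le> 1 \<and>
        ((\<lambda>s. heis_mult g (\<gamma> s)) has_vector_derivative horiz (heis_mult g (\<gamma> s)) a b) (at s)"
      using ab(1) by (auto simp: mult)
  qed (use \<gamma> in auto)
qed

text \<open>The path is a straight Euclidean line: the horizontal vector with constant coefficients
  does not change along its own direction.\<close>

lemma reach_segment: "reach P (heis_mult P (u, v, 0)) (norm (u, v))"
proof -
  define T where "T = norm (u, v)"
  define D where "D = horiz P (u / T) (v / T)"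
  have T2: "T\<^sup>2 = u\<^sup>2 + v\<^sup>2"
    by (simp add: T_def norm_Pair)
  \<comment> \<open>If \<open>T = 0\<close>, the quotients are 0 by convention, and \<open>u\<close>
    and \<open>v\<close> vanish as well.\<close>
  have uv: "T * (u / T) = u" "T * (v / T) = v"
  proof -
    have "u = 0 \<and> v = 0" if "T = 0"
      using that T2 by (simp add: sum_power2_eq_zero_iff)
    then show "T * (u / T) = u" "T * (v / T) = v"
      by (cases "T = 0"; simp)+
  qed
  show ?thesis
    unfolding T_def[symmetric]
  proof (rule reachI)
    show "(norm D)-lipschitz_on {0..T} (\<lambda>s. P + s *\<^sub>R D)"
    proof (rule lipschitz_onI)
      show "dist (P + x *\<^sub>R D) (P + y *\<^sub>R D) \<le> norm D * dist x y" for x y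
        using norm_scaleR[of "x - y" D] by (simp add: dist_norm scaleR_diff_left)
    qed simp
    have "P + T *\<^sub>R D = (fst P + T * (u / T), fst (snd P) + T * (v / T),
        snd (snd P) + 2 * (T * (u / T) * fst (snd P) - T * (v / T) * fst P))"
      by (simp add: D_def horiz_def prod_eq_iff algebra_simps)
    then show "P + T *\<^sub>R D = heis_mult P (u, v, 0)"
      unfolding uv by (simp add: heis_mult_def case_prod_beta)
    fix s assume "s \<in> {0<..<T} - {}"
    then have "T > 0" by simp
    then have "(u / T)\<^sup>2 + (v / T)\<^sup>2 \<le> 1"
      using T2 by (simp add: power_divide flip: add_divide_distrib)
    moreover have "((\<lambda>s. P + s *\<^sub>R D) has_vector_derivative D) (at s)"
      by (auto intro!: derivative_eq_intros)
    moreover have "horiz (P + s *\<^sub>R D) (u / T) (v / T) = D"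
      by (simp add: D_def horiz_def algebra_simps)
    ultimately show "\<exists>a b. a\<^sup>2 + b\<^sup>2 \<le> 1 \<and>
        ((\<lambda>s. P + s *\<^sub>R D) has_vector_derivative horiz (P + s *\<^sub>R D) a b) (at s)"
      by metis
  qed (auto simp: T_def)
qed

lemma reach_stay:
  assumes "T \<ge> 0"
  shows "reach P P T"
proof (rule reachI[OF assms])
  show "0-lipschitz_on {0..T} (\<lambda>s. P)"
    by (simp add: lipschitz_on_def)
  show "\<exists>a b. a\<^sup>2 + b\<^sup>2 \<le> 1 \<and> ((\<lambda>s. P) has_vector_derivative horiz P a b) (at s)" for s
    by (intro exI[of _ 0]) (simp add: horiz_def flip: zero_prod_def)
qed auto

text \<open>The commutator of \<open>(r, 0, 0)\<close> and \<open>(0, q, 0)\<close> is \<open>(0, 0, - 4 r q)\<close>.\<close>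

lemma reach_vertical: "reach P (heis_mult P (0, 0, t)) (2 * sqrt \<bar>t\<bar>)"
proof -
  \<comment> \<open>The commutator projects to a square with sides \<open>r\<close>; its height
    \<open>4 * r\<^sup>2\<close> has to be \<open>\<bar>t\<bar>\<close>, and the sign of
    \<open>q\<close> fixes the orientation.\<close>
  define r where "r = sqrt \<bar>t\<bar> / 2"
  define q where "q = - sgn t * r"
  have "r \<ge> 0"
    by (simp add: r_def)
  moreover have "\<bar>q\<bar> = r"
    using \<open>r \<ge> 0\<close> by (cases "t = 0") (auto simp: q_def r_def abs_mult abs_sgn_eq)
  ultimately have len: "norm (r, 0::real) = r" "norm (0::real, q) = r" "norm (- r, 0::real) = r" "norm (0::real, - q) = r"
    by (simp_all add: norm_Pair)
  have "- 4 * r * q = sgn t * (sqrt \<bar>t\<bar>)\<^sup>2"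
    by (simp add: q_def r_def power2_eq_square field_simps)
  then have t: "- 4 * r * q = t"
    by (simp add: sgn_mult_abs)
  let ?P1 = "heis_mult P (r, 0, 0)"
  let ?P2 = "heis_mult ?P1 (0, q, 0)"
  let ?P3 = "heis_mult ?P2 (- r, 0, 0)"
  have "reach P (heis_mult ?P3 (0, - q, 0)) (r + r + r + r)"
    using reach_segment[of P r 0] reach_segment[of ?P1 0 q] reach_segment[of ?P2 "- r" 0]
      reach_segment[of ?P3 0 "- q"]
    unfolding len by (blast intro: reach_trans)
  moreover have "heis_mult ?P3 (0, - q, 0) = heis_mult P (0, 0, - 4 * r * q)"
    by (simp add: heis_mult_def case_prod_beta algebra_simps)
  moreover have "r + r + r + r = 2 * sqrt \<bar>t\<bar>"
    by (simp add: r_def)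
  ultimately show ?thesis
    unfolding t by metis
qed

text \<open>A straight segment to the vertical line through \<open>Q\<close>, then a vertical move.
  Besides the explicit bound, this shows that \<open>control_dist\<close> is never the infimum of an
  empty set.\<close>

lemma reach_any: "reach P Q (norm (hproj Q - hproj P) + 2 * sqrt \<bar>vert P Q\<bar>)"
proof -
  let ?w = "hproj Q - hproj P"
  have "reach P (heis_mult P (fst ?w, snd ?w, 0)) (norm ?w)"
    using reach_segment[of P "fst ?w" "snd ?w"] by (simp only: prod.collapse)
  moreover have "heis_mult (heis_mult P (fst ?w, snd ?w, 0)) (0, 0, vert P Q) = Q"
    by (simp add: heis_mult_def case_prod_beta hproj_def vert_def prod_eq_iff algebra_simps)
  ultimately show ?thesis
    using reach_vertical[of "heis_mult P (fst ?w, snd ?w, 0)" "vert P Q"] reach_trans by metis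
qed

section \<open>Upper and lower bounds for the control distance\<close>

text \<open>\<open>reach\<close> only provides coefficients separately at each time. They are
  nevertheless measurable: they are the horizontal part of the derivative off a null set, and
  \<open>abs_cont_absolutely_integrable\<close> applies to that derivative.\<close>

lemma reach_horizontal_curve:
  assumes "reach P Q T" "T > 0"
  obtains \<gamma> a b where "horizontal_curve 0 T \<gamma> a b" "\<gamma> 0 = P" "\<gamma> T = Q" "horizontal_length 0 T a b \<le> T"
proof -
  obtain \<gamma> N C where \<gamma>: "T \<ge> 0" "negligible N" "C-lipschitz_on {0..T} \<gamma>" "\<gamma> 0 = P" "\<gamma> T = Q"
    "\<And>s. s \<in> {0<..<T} - N \<Longrightarrow> \<exists>a b. a\<^sup>2 + b\<^sup>2 \<le> 1 \<and> (\<gamma> has_vector_derivative horiz (\<gamma> s) a b) (at s)"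
    using assms(1) unfolding reach_def by blast
  \<comment> \<open>\<open>reach\<close> provides derivatives at interior times only, so the
    endpoints become exceptional.\<close>
  define N' where "N' = insert 0 (insert T N)"
  have neg: "negligible N'"
    using \<gamma>(2) by (simp add: N'_def)
  have "\<exists>c. norm c \<le> 1 \<and> (s \<in> {0..T} - N' \<longrightarrow> (\<gamma> has_vector_derivative horiz (\<gamma> s) (fst c) (snd c)) (at s))" for s
  proof (cases "s \<in> {0..T} - N'")
    case True
    then obtain a b where "a\<^sup>2 + b\<^sup>2 \<le> 1" "(\<gamma> has_vector_derivative horiz (\<gamma> s) a b) (at s)"
      using \<gamma>(6)[of s] by (force simp: N'_def)
    then show ?thesis
      by (intro exI[of _ "(a, b)"]) (auto simp: norm_Pair)
  qed (auto intro!: exI[of _ 0])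
  then obtain c where c: "\<And>s. norm (c s) \<le> 1"
    "\<And>s. s \<in> {0..T} - N' \<Longrightarrow> (\<gamma> has_vector_derivative horiz (\<gamma> s) (fst (c s)) (snd (c s))) (at s)"
    by metis
  have ac: "abs_cont_on 0 T \<gamma>"
    using \<gamma>(3) by (rule lipschitz_imp_abs_cont_on)
  define F where "F s = horiz (\<gamma> s) (fst (c s)) (snd (c s))" for s
  have deriv: "(\<gamma> has_vector_derivative F s) (at s within {0..T})" if "s \<in> {0..T} - N'" for s
    using c(2)[OF that] unfolding F_def by (rule has_vector_derivative_at_within)
  have F_ai: "F absolutely_integrable_on {0..T}"
    using ac \<open>T \<ge> 0\<close> neg deriv by (rule abs_cont_absolutely_integrable)
  have cF: "c = (\<lambda>v. (fst v, fst (snd v))) \<circ> F"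
    by (auto simp: F_def horiz_def)
  have c_ai: "c absolutely_integrable_on {0..T}"
    unfolding cF by (rule absolutely_integrable_linear[OF F_ai bounded_linear_horizontal_part])
  have nc_ai: "(\<lambda>s. norm (c s)) absolutely_integrable_on {0..T}"
    by (rule absolutely_integrable_norm[OF c_ai, unfolded o_def])
  have "horizontal_length 0 T (fst \<circ> c) (snd \<circ> c) = integral {0..T} (\<lambda>s. norm (c s))"
    using set_lebesgue_integral_eq_integral(2)[OF nc_ai]
    by (simp add: horizontal_length_def norm_prod_def)
  also have "\<dots> \<le> integral {0..T} (\<lambda>s. 1)"
    using c(1) set_lebesgue_integral_eq_integral(1)[OF nc_ai] by (intro integral_le) auto
  finally have len: "horizontal_length 0 T (fst \<circ> c) (snd \<circ> c) \<le> T"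
    using \<open>T \<ge> 0\<close> by simp
  have "horizontal_curve 0 T \<gamma> (fst \<circ> c) (snd \<circ> c)"
    unfolding horizontal_curve_def
  proof (intro conjI ac)
    have meas: "c \<in> borel_measurable (lebesgue_on {0..T})"
      using c_ai by (rule absolutely_integrable_measurable[THEN iffD1, THEN conjunct1, rotated]) simp
    have "fst \<in> borel_measurable (borel :: (real \<times> real) measure)" "snd \<in> borel_measurable (borel :: (real \<times> real) measure)"
      by (auto intro!: borel_measurable_continuous_onI continuous_intros)
    then show "fst \<circ> c \<in> borel_measurable (lebesgue_on {0..T})" "snd \<circ> c \<in> borel_measurable (lebesgue_on {0..T})"
      using meas by (auto intro: measurable_comp)
    have "AE s in lebesgue. s \<notin> N'"
      using neg by (auto simp: negligible_iff_null_sets intro: AE_not_in)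
    then show "AE s in lebesgue_on {0..T}. (\<gamma> has_vector_derivative
        (fst \<circ> c) s *\<^sub>R fieldX (\<gamma> s) + (snd \<circ> c) s *\<^sub>R fieldY (\<gamma> s)) (at s within {0..T})"
      using deriv unfolding horizontal_field_eq
      by (subst AE_restrict_space_iff) (auto simp: F_def horiz_def elim!: eventually_mono)
  qed
  with that len \<gamma>(4,5) show thesis
    by blast
qed

lemma control_dist_le_reach:
  assumes "reach P Q T"
  shows "control_dist P Q \<le> T"
proof (rule field_le_epsilon)
  fix e :: real assume "e > 0"
  \<comment> \<open>\<open>control_dist\<close> requires \<alpha> < \<beta>, while \<open>T\<close>
    may be 0; waiting for an extra time \<open>e\<close> makes the interval nondegenerate.\<close>
  then have "reach P Q (T + e)" "T + e > 0"
    using reach_trans[OF assms reach_stay[of e]] assms by (auto simp: reach_def)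
  then obtain \<gamma> a b where *: "horizontal_curve 0 (T + e) \<gamma> a b" "\<gamma> 0 = P" "\<gamma> (T + e) = Q"
      "horizontal_length 0 (T + e) a b \<le> T + e"
    by (rule reach_horizontal_curve)
  have "control_dist P Q \<le> horizontal_length 0 (T + e) a b"
    unfolding control_dist_def
  proof (rule cInf_lower)
    show "bdd_below {horizontal_length \<alpha> \<beta> a b |\<alpha> \<beta> a b. \<alpha> < \<beta> \<and> (\<exists>\<gamma>. horizontal_curve \<alpha> \<beta> \<gamma> a b \<and> \<gamma> \<alpha> = P \<and> \<gamma> \<beta> = Q)}"
      by (rule bdd_belowI[of _ 0])
        (auto simp: horizontal_length_def set_lebesgue_integral_def intro!: integral_nonneg_AE)
  qed (use * \<open>T + e > 0\<close> in blast)
  with * show "control_dist P Q \<le> T + e"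
    by linarith
qed

lemma control_dist_ge:
  assumes "\<And>\<alpha> \<beta> a b \<gamma>. \<alpha> < \<beta> \<Longrightarrow> horizontal_curve \<alpha> \<beta> \<gamma> a b \<Longrightarrow> \<gamma> \<alpha> = P \<Longrightarrow> \<gamma> \<beta> = Q \<Longrightarrow>
    m \<le> horizontal_length \<alpha> \<beta> a b"
  shows "m \<le> control_dist P Q"
  unfolding control_dist_def
proof (rule cInf_greatest)
  define T where "T = norm (hproj Q - hproj P) + 2 * sqrt \<bar>vert P Q\<bar> + 1"
  have "reach P Q T" "T > 0"
    using reach_trans[OF reach_any reach_stay[of 1]] by (auto simp: T_def add_nonneg_pos)
  then obtain \<gamma> a b where "horizontal_curve 0 T \<gamma> a b" "\<gamma> 0 = P" "\<gamma> T = Q"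
    by (rule reach_horizontal_curve)
  then show "{horizontal_length \<alpha> \<beta> a b |\<alpha> \<beta> a b. \<alpha> < \<beta> \<and> (\<exists>\<gamma>. horizontal_curve \<alpha> \<beta> \<gamma> a b \<and> \<gamma> \<alpha> = P \<and> \<gamma> \<beta> = Q)} \<noteq> {}"
    using \<open>T > 0\<close> by blast
next
  fix l assume "l \<in> {horizontal_length \<alpha> \<beta> a b |\<alpha> \<beta> a b. \<alpha> < \<beta> \<and> (\<exists>\<gamma>. horizontal_curve \<alpha> \<beta> \<gamma> a b \<and> \<gamma> \<alpha> = P \<and> \<gamma> \<beta> = Q)}"
  then obtain \<alpha> \<beta> a b \<gamma> where "l = horizontal_length \<alpha> \<beta> a b" "\<alpha> < \<beta>" "horizontal_curve \<alpha> \<beta> \<gamma> a b" "\<gamma> \<alpha> = P" "\<gamma> \<beta> = Q"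
    by auto
  then show "m \<le> l"
    using assms by simp
qed

lemma norm_hproj_le_control_dist: "norm (hproj Q - hproj P) \<le> control_dist P Q"
  using horizontal_curve_bounds(1) by (intro control_dist_ge) blast

lemma vert_le_control_dist: "\<bar>vert P Q\<bar> \<le> 2 * (control_dist P Q)\<^sup>2"
proof -
  \<comment> \<open>The infimum is over lengths, not over their squares, so the estimate is first
    put in square-root form.\<close>
  have "sqrt (\<bar>vert P Q\<bar> / 2) \<le> control_dist P Q"
  proof (rule control_dist_ge)
    fix \<alpha> \<beta> a b \<gamma>
    assume *: "\<alpha> < \<beta>" "horizontal_curve \<alpha> \<beta> \<gamma> a b" "\<gamma> \<alpha> = P" "\<gamma> \<beta> = Q"
    have "0 \<le> horizontal_length \<alpha> \<beta> a b"
      using horizontal_curve_bounds(1)[OF *(1,2)] norm_ge_zero order_trans by blast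
    then show "sqrt (\<bar>vert P Q\<bar> / 2) \<le> horizontal_length \<alpha> \<beta> a b"
      using horizontal_curve_bounds(2)[OF *(1,2)] * by (intro real_le_lsqrt) auto
  qed
  then have "(sqrt (\<bar>vert P Q\<bar> / 2))\<^sup>2 \<le> (control_dist P Q)\<^sup>2"
    by (intro power_mono) auto
  then show ?thesis
    by simp
qed

section \<open>Quasigeodesics\<close>

text \<open>Since \<open>vert\<close> is a coordinate of a group quotient, this is the group law:
  the defect of additivity is four times the signed area of the projected triangle.\<close>

lemma vert_mult:
  "vert P R = vert P Q + vert Q R + 2 * (fst (hproj R - hproj Q) * snd (hproj Q - hproj P)
     - fst (hproj Q - hproj P) * snd (hproj R - hproj Q))"
  by (simp add: vert_def hproj_def algebra_simps)

lemma symplectic_bound: "\<bar>fst w * snd v - fst v * snd w\<bar> \<le> norm v * norm (w :: real \<times> real)"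
proof -
  have "fst w * snd v - fst v * snd w = (snd v, - fst v) \<bullet> w"
    by (simp add: inner_prod_def algebra_simps)
  moreover have "norm (snd v, - fst v) = norm v"
    by (simp add: norm_Pair norm_prod_def add.commute)
  ultimately show ?thesis
    using Cauchy_Schwarz_ineq2[of "(snd v, - fst v)" w] by simp
qed

lemma DERIV_zero_of_quadratic_bound:
  fixes f :: "real \<Rightarrow> real"
  assumes "\<And>y. \<bar>f y\<bar> \<le> C * (y - x)\<^sup>2"
  shows "(f has_real_derivative 0) (at x)"
  unfolding has_field_derivative_def has_derivative_at_alt
proof (intro conjI allI impI)
  have "\<bar>f x\<bar> \<le> 0"
    using assms[of x] by simp
  then have fx: "f x = 0"
    by simp
  fix e :: real assume e: "e > 0"
  show "\<exists>d>0. \<forall>y. norm (y - x) < d \<longrightarrow> norm (f y - f x - 0 * (y - x)) \<le> e * norm (y - x)"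
  proof (intro exI[of _ "e / (\<bar>C\<bar> + 1)"] conjI allI impI)
    fix y assume "norm (y - x) < e / (\<bar>C\<bar> + 1)"
    then have y: "(\<bar>C\<bar> + 1) * \<bar>y - x\<bar> \<le> e"
      by (simp add: field_simps)
    have "\<bar>f y\<bar> \<le> C * (y - x)\<^sup>2"
      by (rule assms)
    also have "\<dots> \<le> (\<bar>C\<bar> + 1) * (y - x)\<^sup>2"
      by (intro mult_right_mono) auto
    also have "\<dots> = (\<bar>C\<bar> + 1) * \<bar>y - x\<bar> * \<bar>y - x\<bar>"
      by (simp add: power2_eq_square mult.assoc flip: abs_mult)
    also have "\<dots> \<le> e * \<bar>y - x\<bar>"
      using y by (intro mult_right_mono) auto
    finally show "norm (f y - f x - 0 * (y - x)) \<le> e * norm (y - x)"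
      by (simp add: fx)
  qed (use e in simp)
qed (rule bounded_linear_mult_right)

lemma norm_vector_derivative_le:
  assumes deriv: "(f has_vector_derivative c) (at s)"
    and lip: "\<And>y. norm (f y - f s) \<le> k * \<bar>y - s\<bar>"
  shows "norm c \<le> k"
proof (rule field_le_epsilon)
  fix e :: real assume "e > 0"
  then obtain d where d: "d > 0" "\<And>y. norm (y - s) < d \<Longrightarrow> norm (f y - f s - (y - s) *\<^sub>R c) \<le> e * norm (y - s)"
    using deriv unfolding has_vector_derivative_def has_derivative_at_alt by blast
  define h where "h = d / 2"
  have h: "h > 0" "h < d"
    using d by (auto simp: h_def)
  have "norm (h *\<^sub>R c) \<le> norm (f (s + h) - f s) + norm (f (s + h) - f s - h *\<^sub>R c)"
    using norm_triangle_ineq4[of "f (s + h) - f s" "f (s + h) - f s - h *\<^sub>R c"] by simp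
  also have "\<dots> \<le> k * h + e * h"
    using lip[of "s + h"] d(2)[of "s + h"] h by simp
  finally have "h * norm c \<le> h * (k + e)"
    using h by (simp add: algebra_simps)
  then show "norm c \<le> k + e"
    using h by simp
qed

section \<open>Quasigeodesics are horizontal\<close>

lemma quasigeodesic_hproj:
  assumes "quasigeodesic k \<gamma>"
  shows "norm (hproj (\<gamma> s') - hproj (\<gamma> s)) \<le> k * \<bar>s' - s\<bar>"
  using assms norm_hproj_le_control_dist[of "\<gamma> s'" "\<gamma> s"] abs_minus_commute[of s s']
  unfolding quasigeodesic_def by (metis order_trans)

lemma quasigeodesic_vert:
  assumes "quasigeodesic k \<gamma>"
  shows "\<bar>vert (\<gamma> s) (\<gamma> s')\<bar> \<le> 2 * k\<^sup>2 * (s' - s)\<^sup>2"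
proof -
  have "0 \<le> control_dist (\<gamma> s) (\<gamma> s')"
    using norm_hproj_le_control_dist norm_ge_zero order_trans by blast
  moreover have "control_dist (\<gamma> s) (\<gamma> s') \<le> k * \<bar>s' - s\<bar>"
    using assms abs_minus_commute[of s s'] unfolding quasigeodesic_def by metis
  ultimately have "(control_dist (\<gamma> s) (\<gamma> s'))\<^sup>2 \<le> (k * \<bar>s' - s\<bar>)\<^sup>2"
    by (intro power_mono)
  then show ?thesis
    using vert_le_control_dist[of "\<gamma> s" "\<gamma> s'"] by (simp add: power_mult_distrib)
qed

lemma quasigeodesic_hproj_lipschitz:
  assumes "quasigeodesic k \<gamma>" "k \<ge> 0"
  shows "k-lipschitz_on S (\<lambda>s. hproj (\<gamma> s))"
  using quasigeodesic_hproj[OF assms(1)] assms(2) by (intro lipschitz_onI) (auto simp: dist_norm)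

text \<open>The planar coordinates are Lipschitz, hence differentiable almost everywhere. The
  vertical displacement from \<open>\<gamma> s\<close> is quadratic in time, so its derivative at
  \<open>s\<close> is 0; this gives the derivative of the third coordinate and is precisely the
  horizontality equation.\<close>

lemma quasigeodesic_horizontal:
  assumes quasi: "quasigeodesic k \<gamma>" and k: "k \<ge> 0"
  obtains N c where "negligible N" "\<And>s. norm (c s) \<le> k"
    "\<And>s. s \<notin> N \<Longrightarrow> (\<gamma> has_vector_derivative horiz (\<gamma> s) (fst (c s)) (snd (c s))) (at s)"
    "\<And>s. s \<notin> N \<Longrightarrow> ((\<lambda>s. hproj (\<gamma> s)) has_vector_derivative c s) (at s)"
proof -
  define x y t where "x s = fst (\<gamma> s)" and "y s = fst (snd (\<gamma> s))" and "t s = snd (snd (\<gamma> s))" for s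
  have \<gamma>: "\<gamma> = (\<lambda>s. (x s, y s, t s))" and hp: "hproj (\<gamma> s) = (x s, y s)" for s
    by (auto simp: x_def y_def t_def hproj_def)
  have "norm (x r - x s) \<le> k * \<bar>r - s\<bar>" "norm (y r - y s) \<le> k * \<bar>r - s\<bar>" for r s
    using quasigeodesic_hproj[OF quasi, of r s] norm_fst_le[of "x r - x s" "y r - y s"]
      norm_snd_le[of "y r - y s" "x r - x s"]
    by (simp_all add: hp)
  then have "k-lipschitz_on UNIV x" "k-lipschitz_on UNIV y"
    using k by (auto intro!: lipschitz_onI simp: dist_norm)
  then obtain N1 N2 where N: "negligible N1" "negligible N2"
    "\<And>s. s \<notin> N1 \<Longrightarrow> x differentiable (at s)" "\<And>s. s \<notin> N2 \<Longrightarrow> y differentiable (at s)"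
    by (metis lipschitz_differentiable_ae)
  have "\<exists>c. norm c \<le> k \<and> (s \<notin> N1 \<union> N2 \<longrightarrow>
      (\<gamma> has_vector_derivative horiz (\<gamma> s) (fst c) (snd c)) (at s) \<and>
      ((\<lambda>s. hproj (\<gamma> s)) has_vector_derivative c) (at s))" for s
  proof (cases "s \<in> N1 \<union> N2")
    case True
    then show ?thesis
      using k by (intro exI[of _ 0]) simp
  next
    case False
    then have "x differentiable (at s)" "y differentiable (at s)"
      using N(3,4) by auto
    then obtain a b where ab: "(x has_real_derivative a) (at s)" "(y has_real_derivative b) (at s)"
      unfolding real_differentiable_def by blast
    have v0: "((\<lambda>s'. vert (\<gamma> s) (\<gamma> s')) has_real_derivative 0) (at s)"
      using quasigeodesic_vert[OF quasi] by (rule DERIV_zero_of_quadratic_bound)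
    have "((\<lambda>s'. t s + vert (\<gamma> s) (\<gamma> s') + 2 * (x s' * y s - x s * y s')) has_real_derivative
        2 * (a * y s - b * x s)) (at s)"
      using ab v0 by (auto intro!: derivative_eq_intros)
    also have "(\<lambda>s'. t s + vert (\<gamma> s) (\<gamma> s') + 2 * (x s' * y s - x s * y s')) = t"
      by (auto simp: vert_def \<gamma>)
    finally have "(\<gamma> has_vector_derivative (a, b, 2 * (a * y s - b * x s))) (at s)"
      using ab unfolding \<gamma> has_real_derivative_iff_has_vector_derivative
      by (intro has_vector_derivative_Pair)
    moreover have "((\<lambda>s. hproj (\<gamma> s)) has_vector_derivative (a, b)) (at s)"
      using ab unfolding hp has_real_derivative_iff_has_vector_derivative
      by (intro has_vector_derivative_Pair)
    moreover from this have "norm (a, b) \<le> k"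
      by (rule norm_vector_derivative_le) (rule quasigeodesic_hproj[OF quasi])
    ultimately show ?thesis
      by (intro exI[of _ "(a, b)"]) (simp add: horiz_def x_def y_def)
  qed
  then obtain c where c: "\<And>s. norm (c s) \<le> k"
    "\<And>s. s \<notin> N1 \<union> N2 \<Longrightarrow> (\<gamma> has_vector_derivative horiz (\<gamma> s) (fst (c s)) (snd (c s))) (at s)"
    "\<And>s. s \<notin> N1 \<union> N2 \<Longrightarrow> ((\<lambda>s. hproj (\<gamma> s)) has_vector_derivative c s) (at s)"
    by metis
  have "negligible (N1 \<union> N2)"
    using N(1,2) by simp
  from that[OF this c] show thesis .
qed

text \<open>\<open>reach\<close> asks for a Euclidean Lipschitz bound. It is local because the third
  coordinate changes at a rate that grows with the distance from the vertical axis, which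
  \<open>B\<close> bounds on the interval.\<close>

lemma quasigeodesic_lipschitz:
  assumes quasi: "quasigeodesic k \<gamma>" and k: "k \<ge> 0"
  shows "\<exists>C. C-lipschitz_on {u..v} \<gamma>"
proof -
  define B where "B = norm (hproj (\<gamma> u)) + k * \<bar>v - u\<bar>"
  define C where "C = k + (2 * k\<^sup>2 * \<bar>v - u\<bar> + 2 * B * k)"
  have "C-lipschitz_on {u..v} \<gamma>"
  proof (rule lipschitz_onI)
    fix s s' assume s: "s \<in> {u..v}" "s' \<in> {u..v}"
    let ?h = "\<bar>s' - s\<bar>" and ?P = "\<gamma> s" and ?Q = "\<gamma> s'"
    have z: "norm (hproj ?Q - hproj ?P) \<le> k * ?h"
      by (rule quasigeodesic_hproj[OF quasi])
    have "norm (hproj ?P) \<le> norm (hproj (\<gamma> u)) + norm (hproj ?P - hproj (\<gamma> u))"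
      by (rule norm_triangle_sub)
    also have "norm (hproj ?P - hproj (\<gamma> u)) \<le> k * \<bar>s - u\<bar>"
      by (rule quasigeodesic_hproj[OF quasi])
    also have "\<dots> \<le> k * \<bar>v - u\<bar>"
      using s k by (intro mult_left_mono) auto
    finally have B: "norm (hproj ?P) \<le> B"
      by (simp add: B_def)
    have "\<bar>vert ?P ?Q\<bar> \<le> 2 * k\<^sup>2 * (s' - s)\<^sup>2"
      by (rule quasigeodesic_vert[OF quasi])
    also have "\<dots> = 2 * k\<^sup>2 * ?h * ?h"
      by (simp add: power2_eq_square flip: abs_mult)
    also have "\<dots> \<le> 2 * k\<^sup>2 * \<bar>v - u\<bar> * ?h"
      using s by (intro mult_right_mono mult_left_mono) auto
    finally have v: "\<bar>vert ?P ?Q\<bar> \<le> 2 * k\<^sup>2 * \<bar>v - u\<bar> * ?h" .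
    define p w where "p = hproj ?P" and "w = hproj ?Q - hproj ?P"
    have t_eq: "snd (snd ?Q) - snd (snd ?P) = vert ?P ?Q + 2 * (fst w * snd p - fst p * snd w)"
      by (simp add: vert_def hproj_def p_def w_def algebra_simps)
    have "\<bar>fst w * snd p - fst p * snd w\<bar> \<le> norm p * norm w"
      by (rule symplectic_bound)
    also have "\<dots> \<le> B * (k * ?h)"
      using B z k by (intro mult_mono) (auto simp: p_def w_def intro: order_trans[OF norm_ge_zero])
    finally have E: "\<bar>fst w * snd p - fst p * snd w\<bar> \<le> B * (k * ?h)" .
    have "\<bar>A + 2 * D\<bar> \<le> a + 2 * b" if "\<bar>A\<bar> \<le> a" "\<bar>D\<bar> \<le> b" for A D a b :: real
      using that by linarith
    from this[OF v E] have t: "\<bar>snd (snd ?Q) - snd (snd ?P)\<bar> \<le> 2 * k\<^sup>2 * \<bar>v - u\<bar> * ?h + 2 * (B * (k * ?h))"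
      unfolding t_eq .
    have "dist ?P ?Q = norm (fst ?Q - fst ?P, fst (snd ?Q) - fst (snd ?P), snd (snd ?Q) - snd (snd ?P))"
      by (simp add: dist_norm norm_prod_def power2_commute)
    also have "\<dots> = norm (hproj ?Q - hproj ?P, snd (snd ?Q) - snd (snd ?P))"
      by (simp add: norm_Pair hproj_def add.assoc)
    also have "\<dots> \<le> norm (hproj ?Q - hproj ?P) + norm (snd (snd ?Q) - snd (snd ?P))"
      by (rule norm_Pair_le)
    also have "\<dots> \<le> k * ?h + (2 * k\<^sup>2 * \<bar>v - u\<bar> * ?h + 2 * (B * (k * ?h)))"
      using z t by simp
    also have "\<dots> = C * dist s s'"
      by (simp add: C_def dist_real_def abs_minus_commute algebra_simps)
    finally show "dist ?P ?Q \<le> C * dist s s'" .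
  qed (use k in \<open>simp add: C_def B_def\<close>)
  then show ?thesis by blast
qed

text \<open>Slowed down by the factor \<open>k\<close>, the curve has planar speed at most 1; as a
  path in \<open>reach\<close> it can be translated and concatenated.\<close>

lemma quasigeodesic_reach:
  assumes quasi: "quasigeodesic k \<gamma>" and k: "k > 0" and "u \<le> v"
  shows "reach (\<gamma> u) (\<gamma> v) (k * (v - u))"
proof -
  obtain N c where N: "negligible N" "\<And>s. norm (c s) \<le> k"
    "\<And>s. s \<notin> N \<Longrightarrow> (\<gamma> has_vector_derivative horiz (\<gamma> s) (fst (c s)) (snd (c s))) (at s)"
    using quasigeodesic_horizontal[OF quasi] k by (metis less_imp_le)
  obtain C where C: "C-lipschitz_on {u..v} \<gamma>"
    using quasigeodesic_lipschitz[OF quasi] k by (metis less_imp_le)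
  define \<theta> where "\<theta> s = u + s / k" for s
  show ?thesis
  proof (rule reachI)
    show "negligible ((\<lambda>x. k * (x - u)) ` N)"
    proof (rule negligible_locally_Lipschitz_image[OF _ N(1)])
      show "\<exists>T B. open T \<and> x \<in> T \<and> (\<forall>y\<in>N \<inter> T. norm (k * (y - u) - k * (x - u)) \<le> B * norm (y - x))" for x
        using k by (intro exI[of _ UNIV] exI[of _ k]) (auto simp: abs_mult simp flip: right_diff_distrib)
    qed simp
    show "(C / k)-lipschitz_on {0..k * (v - u)} (\<lambda>s. \<gamma> (\<theta> s))"
    proof (rule lipschitz_onI)
      fix s s' assume "s \<in> {0..k * (v - u)}" "s' \<in> {0..k * (v - u)}"
      then have "\<theta> s \<in> {u..v}" "\<theta> s' \<in> {u..v}"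
        using k by (auto simp: \<theta>_def field_simps)
      then have "dist (\<gamma> (\<theta> s)) (\<gamma> (\<theta> s')) \<le> C * dist (\<theta> s) (\<theta> s')"
        by (rule lipschitz_onD[OF C])
      also have "dist (\<theta> s) (\<theta> s') = dist s s' / k"
        using k by (simp add: \<theta>_def dist_real_def flip: diff_divide_distrib)
      finally show "dist (\<gamma> (\<theta> s)) (\<gamma> (\<theta> s')) \<le> C / k * dist s s'"
        by simp
    qed (use k lipschitz_on_nonneg[OF C] in simp)
    fix s assume s: "s \<in> {0<..<k * (v - u)} - (\<lambda>x. k * (x - u)) ` N"
    have "s = k * (\<theta> s - u)"
      using k by (simp add: \<theta>_def)
    then have "\<theta> s \<notin> N"
      using s by blast
    note \<gamma>' = N(3)[OF this]
    have "(\<theta> has_vector_derivative 1 / k) (at s)"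
      unfolding \<theta>_def by (auto intro!: derivative_eq_intros)
    from vector_diff_chain_at[OF this \<gamma>']
    have "((\<lambda>s. \<gamma> (\<theta> s)) has_vector_derivative
        (1 / k) *\<^sub>R horiz (\<gamma> (\<theta> s)) (fst (c (\<theta> s))) (snd (c (\<theta> s)))) (at s)"
      by (simp add: o_def)
    also have "(1 / k) *\<^sub>R horiz (\<gamma> (\<theta> s)) (fst (c (\<theta> s))) (snd (c (\<theta> s))) =
        horiz (\<gamma> (\<theta> s)) (fst (c (\<theta> s)) / k) (snd (c (\<theta> s)) / k)"
      by (simp add: horiz_def diff_divide_distrib right_diff_distrib)
    finally have deriv: "((\<lambda>s. \<gamma> (\<theta> s)) has_vector_derivative
        horiz (\<gamma> (\<theta> s)) (fst (c (\<theta> s)) / k) (snd (c (\<theta> s)) / k)) (at s)" .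
    have "(norm (c (\<theta> s)))\<^sup>2 \<le> k\<^sup>2"
      using N(2) by (intro power_mono) auto
    then have "(fst (c (\<theta> s)) / k)\<^sup>2 + (snd (c (\<theta> s)) / k)\<^sup>2 \<le> 1"
      using k by (simp add: power_divide norm_prod_def flip: add_divide_distrib)
    with deriv show "\<exists>a b. a\<^sup>2 + b\<^sup>2 \<le> 1 \<and>
        ((\<lambda>s. \<gamma> (\<theta> s)) has_vector_derivative horiz (\<gamma> (\<theta> s)) a b) (at s)"
      by blast
  qed (use assms in \<open>auto simp: \<theta>_def\<close>)
qed

lemma quasigeodesic_horizontal_speed:
  assumes quasi: "quasigeodesic k \<gamma>" and k: "k \<ge> 0" and "u \<le> v"
  shows "horizontal_speed \<gamma> absolutely_integrable_on {u..v}"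
    and "integral {u..v} (horizontal_speed \<gamma>) = hproj (\<gamma> v) - hproj (\<gamma> u)"
proof -
  obtain N c where N: "negligible N"
    "\<And>s. s \<notin> N \<Longrightarrow> (\<gamma> has_vector_derivative horiz (\<gamma> s) (fst (c s)) (snd (c s))) (at s)"
    "\<And>s. s \<notin> N \<Longrightarrow> ((\<lambda>s. hproj (\<gamma> s)) has_vector_derivative c s) (at s)"
    using quasigeodesic_horizontal[OF quasi k] by metis
  have "horizontal_speed \<gamma> s = c s" if "s \<notin> N" for s
    using horizontal_speed_eq[of \<gamma> "fst (c s)" s "snd (c s)"] N(2)[OF that]
    by (simp add: horizontal_field_eq horiz_def)
  then have deriv: "((\<lambda>s. hproj (\<gamma> s)) has_vector_derivative horizontal_speed \<gamma> s) (at s within {u..v})"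
    if "s \<in> {u..v} - N" for s
    using N(3)[of s] that by (auto intro: has_vector_derivative_at_within)
  have ac: "abs_cont_on u v (\<lambda>s. hproj (\<gamma> s))"
    using quasigeodesic_hproj_lipschitz[OF quasi k] by (rule lipschitz_imp_abs_cont_on)
  show "horizontal_speed \<gamma> absolutely_integrable_on {u..v}"
    using ac \<open>u \<le> v\<close> N(1) deriv by (rule abs_cont_absolutely_integrable)
  show "integral {u..v} (horizontal_speed \<gamma>) = hproj (\<gamma> v) - hproj (\<gamma> u)"
    using abs_cont_has_integral[OF ac \<open>u \<le> v\<close> N(1) deriv] by (rule integral_unique)
qed

section \<open>Escape from discs and the shortcut\<close>

text \<open>If the curve stays within K L, the height reached after \<open>M\<close> steps of
  duration \<open>L\<close> grows only like M K L^2, so the distance is at most of order K L + sqrt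
  (M K) L. A quasigeodesic must reach distance M L / 2, which is impossible once \<open>M\<close> is
  a large multiple of \<open>K\<close>.\<close>

lemma quasigeodesic_escape:
  assumes quasi: "quasigeodesic k \<gamma>" and k: "1 \<le> k" "k \<le> 2" and K: "K \<ge> 1" and L: "L > 0"
  obtains q where "p < q" "q - p \<le> 257 * K * L" "K * L \<le> norm (hproj (\<gamma> q) - hproj (\<gamma> p))"
proof (rule ccontr)
  assume "\<not> thesis"
  with that have near: "norm (hproj (\<gamma> q) - hproj (\<gamma> p)) < K * L" if "p < q" "q - p \<le> 257 * K * L" for q
    using \<open>p < q\<close> \<open>q - p \<le> _\<close> by force
  \<comment> \<open>With 256 one has \<open>8 + 4 * K \<le> 12 * K \<le> 3 / 64 * M\<close>, and the
    distance comes out as at most 113/256 of M L, below one half. Rounding up adds at most 1, which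
    turns 256 into 257.\<close>
  define M where "M = nat \<lceil>256 * K\<rceil>"
  have M: "256 * K \<le> real M" "real M \<le> 257 * K"
    using K by (auto simp: M_def) linarith+
  define s where "s j = p + real j * L" for j
  have s_near: "norm (hproj (\<gamma> (s j)) - hproj (\<gamma> p)) \<le> K * L" if "j \<le> M" for j
  proof (cases "j = 0")
    case True
    then show ?thesis
      using K L by (simp add: s_def)
  next
    case False
    have "real j * L \<le> 257 * K * L"
      using that M L by (intro mult_right_mono) auto
    then show ?thesis
      using near[of "s j"] False L by (simp add: s_def)
  qed
  \<comment> \<open>The 8 is \<open>2 * k\<^sup>2\<close> for \<open>k \<le> 2\<close>;
    \<open>4 * K\<close> is the cross term of \<open>vert_mult\<close>, with displacement at most
    \<open>K * L\<close> and step at most \<open>2 * L\<close>.\<close>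
  have "\<bar>vert (\<gamma> p) (\<gamma> (s j))\<bar> \<le> real j * ((8 + 4 * K) * L\<^sup>2)" if "j \<le> M" for j
    using that
  proof (induction j)
    case 0
    then show ?case
      by (simp add: s_def vert_def)
  next
    case (Suc j)
    let ?v = "hproj (\<gamma> (s j)) - hproj (\<gamma> p)" and ?w = "hproj (\<gamma> (s (Suc j))) - hproj (\<gamma> (s j))"
    have sj: "s (Suc j) - s j = L"
      by (simp add: s_def algebra_simps)
    have "norm ?w \<le> k * \<bar>s (Suc j) - s j\<bar>"
      by (rule quasigeodesic_hproj[OF quasi])
    also have "\<dots> \<le> 2 * L"
      using k L by (simp add: sj)
    finally have "norm ?v * norm ?w \<le> (K * L) * (2 * L)"
      using s_near[of j] Suc.prems K L by (intro mult_mono) auto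
    also have "\<dots> = 2 * K * L\<^sup>2"
      by (simp add: power2_eq_square)
    finally have cross: "\<bar>fst ?w * snd ?v - fst ?v * snd ?w\<bar> \<le> 2 * K * L\<^sup>2"
      by (rule order_trans[OF symplectic_bound])
    have "\<bar>vert (\<gamma> (s j)) (\<gamma> (s (Suc j)))\<bar> \<le> 2 * k\<^sup>2 * (s (Suc j) - s j)\<^sup>2"
      by (rule quasigeodesic_vert[OF quasi])
    also have "\<dots> \<le> 8 * L\<^sup>2"
      using power_mono[of k 2 2] k unfolding sj by (intro mult_right_mono) auto
    finally have "\<bar>vert (\<gamma> (s j)) (\<gamma> (s (Suc j)))\<bar> \<le> 8 * L\<^sup>2" .
    moreover have "\<bar>vert (\<gamma> p) (\<gamma> (s j))\<bar> \<le> real j * ((8 + 4 * K) * L\<^sup>2)"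
      using Suc by simp
    moreover have "real (Suc j) * ((8 + 4 * K) * L\<^sup>2) = real j * ((8 + 4 * K) * L\<^sup>2) + (8 * L\<^sup>2 + 2 * (2 * K * L\<^sup>2))"
      by (simp add: algebra_simps)
    moreover have "\<bar>a + b + 2 * c\<bar> \<le> A + (B + 2 * C)" if "\<bar>b\<bar> \<le> B" "\<bar>a\<bar> \<le> A" "\<bar>c\<bar> \<le> C" for a b c A B C :: real
      using that by linarith
    ultimately show ?case
      unfolding vert_mult[of "\<gamma> p" "\<gamma> (s (Suc j))" "\<gamma> (s j)"] using cross by presburger
  qed
  then have "\<bar>vert (\<gamma> p) (\<gamma> (s M))\<bar> \<le> real M * ((8 + 4 * K) * L\<^sup>2)"
    by blast
  also have "\<dots> \<le> real M * ((3 / 64 * real M) * L\<^sup>2)"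
    using M K by (intro mult_left_mono mult_right_mono) auto
  also have "\<dots> = 3 / 64 * (real M * L)\<^sup>2"
    by (simp add: power2_eq_square)
  \<comment> \<open>3/64 is 48/1024; raising it to 49/1024 gives the square of 7/32.\<close>
  also have "\<dots> \<le> 49 / 1024 * (real M * L)\<^sup>2"
    by (intro mult_right_mono) auto
  also have "\<dots> = (7 / 32 * real M * L)\<^sup>2"
    by (simp add: power2_eq_square)
  finally have "sqrt \<bar>vert (\<gamma> p) (\<gamma> (s M))\<bar> \<le> 7 / 32 * real M * L"
    using L by (intro real_le_lsqrt) auto
  moreover have "norm (hproj (\<gamma> (s M)) - hproj (\<gamma> p)) \<le> 1 / 256 * real M * L"
  proof -
    have "K * L \<le> 1 / 256 * real M * L"
      using M(1) L by (intro mult_right_mono) auto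
    then show ?thesis
      using s_near[of M] by linarith
  qed
  ultimately have "control_dist (\<gamma> p) (\<gamma> (s M)) \<le> 113 / 256 * (real M * L)"
    using control_dist_le_reach[OF reach_any[of "\<gamma> p" "\<gamma> (s M)"]] by simp
  moreover have "1 / 2 * (real M * L) \<le> inverse k * (real M * L)"
    using k L by (intro mult_right_mono) (auto simp: field_simps)
  moreover have dist: "\<bar>p - s M\<bar> = real M * L"
    using L by (simp add: s_def)
  have "inverse k * (real M * L) \<le> control_dist (\<gamma> p) (\<gamma> (s M))"
    unfolding dist[symmetric] using quasi unfolding quasigeodesic_def by blast
  moreover have "real M * L > 0"
    using M K L by simp
  ultimately show False
    by linarith
qed

text \<open>
  Translating \<open>P\<^sub>1 P\<^sub>2\<close> sideways by \<open>l\<close> times the rotated chord changes the enclosed area exactly as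
  replacing the path from \<open>P\<^sub>0\<close> to \<open>P\<^sub>1\<close> by its chord does.
\<close>

lemma sideways_shift:
  fixes x0 y0 t0 x1 y1 t1 x2 y2 t2 l :: real
  assumes "4 * l * ((x2 - x1)\<^sup>2 + (y2 - y1)\<^sup>2) = t1 - t0 - 2 * (x1 * y0 - x0 * y1)"
  defines "A \<equiv> heis_mult (x0, y0, t0) (x1 - x0, y1 - y0, 0)"
  defines "B \<equiv> heis_mult A (- l * (y2 - y1), l * (x2 - x1), 0)"
  defines "E \<equiv> heis_mult (heis_mult B (- x1, - y1, - t1)) (x2, y2, t2)"
  shows "heis_mult E (l * (y2 - y1), - l * (x2 - x1), 0) = (x2, y2, t2)"
proof -
  have "t1 = t0 + 2 * (x1 * y0 - x0 * y1) + 4 * l * ((x2 - x1)\<^sup>2 + (y2 - y1)\<^sup>2)"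
    using assms(1) by simp
  then show ?thesis
    unfolding A_def B_def E_def heis_mult_def by (simp add: power2_eq_square algebra_simps)
qed

text \<open>The constant is 519 = 1 + 2 * 257 + 2 * 2: the loss \<epsilon> L on [u, v]; the loss
  \<epsilon> (q - v), once in the lower bound for the distance and once in the length of the
  translated piece; and the two sideways segments.\<close>

lemma quasigeodesic_chord_ge:
  assumes quasi: "quasigeodesic (1 + \<epsilon>) \<gamma>" and \<epsilon>: "0 < \<epsilon>" "\<epsilon> \<le> 1" and "u < v"
  shows "(1 - 519 * sqrt \<epsilon>) * (v - u) \<le> norm (hproj (\<gamma> v) - hproj (\<gamma> u))"
proof -
  define k where "k = 1 + \<epsilon>"
  have quasi: "quasigeodesic k \<gamma>" and k: "1 \<le> k" "k \<le> 2" "k > 0"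
    using assms by (auto simp: k_def)
  define L where "L = v - u"
  have L: "L > 0"
    using \<open>u < v\<close> by (simp add: L_def)
  define K where "K = 1 / sqrt \<epsilon>"
  have K: "K \<ge> 1" "\<epsilon> * K = sqrt \<epsilon>" "1 / K = sqrt \<epsilon>"
    using \<epsilon> by (auto simp: K_def real_div_sqrt)
  obtain q where q: "v < q" "q - v \<le> 257 * K * L" "K * L \<le> norm (hproj (\<gamma> q) - hproj (\<gamma> v))"
    using quasigeodesic_escape[OF quasi k(1,2) K(1) L] .
  obtain x0 y0 t0 where P0: "\<gamma> u = (x0, y0, t0)"
    by (cases "\<gamma> u")
  obtain x1 y1 t1 where P1: "\<gamma> v = (x1, y1, t1)"
    by (cases "\<gamma> v")
  obtain x2 y2 t2 where P2: "\<gamma> q = (x2, y2, t2)"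
    by (cases "\<gamma> q")
  define \<tau> where "\<tau> = vert (\<gamma> u) (\<gamma> v)"
  define n where "n = norm (x2 - x1, y2 - y1)"
  have n: "K * L \<le> n"
    using q(3) by (simp add: P1 P2 hproj_def n_def)
  moreover have "K * L > 0"
    using K L by simp
  ultimately have "n > 0"
    by linarith
  have n2: "n\<^sup>2 = (x2 - x1)\<^sup>2 + (y2 - y1)\<^sup>2"
    by (simp add: n_def norm_Pair)
  \<comment> \<open>This solves the hypothesis of \<open>sideways_shift\<close>. The cost
    \<open>\<bar>l\<bar> * n\<close> equals \<open>\<bar>\<tau>\<bar> / (4 * n)\<close>, which is
    why a far point with \<open>n \<ge> K * L\<close> is wanted.\<close>
  define l where "l = \<tau> / (4 * n\<^sup>2)"
  have l: "4 * l * ((x2 - x1)\<^sup>2 + (y2 - y1)\<^sup>2) = t1 - t0 - 2 * (x1 * y0 - x0 * y1)"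
    using \<open>n > 0\<close> unfolding n2[symmetric] by (simp add: l_def \<tau>_def vert_def P0 P1)
  define A where "A = heis_mult (x0, y0, t0) (x1 - x0, y1 - y0, 0)"
  define B where "B = heis_mult A (- l * (y2 - y1), l * (x2 - x1), 0)"
  \<comment> \<open>Left translation by \<open>g\<close> takes \<open>\<gamma> v\<close> to
    \<open>B\<close> and the rest of the curve with it; the point \<open>E\<close> of
    \<open>sideways_shift\<close> is the translated \<open>\<gamma> q\<close>.\<close>
  define g where "g = heis_mult B (- x1, - y1, - t1)"
  have gB: "heis_mult g (\<gamma> v) = B"
    by (simp add: g_def P1 heis_mult_def case_prod_beta prod_eq_iff algebra_simps)
  have "reach (\<gamma> u) A (norm (hproj (\<gamma> v) - hproj (\<gamma> u)))"
    using reach_segment[of "\<gamma> u" "x1 - x0" "y1 - y0"] by (simp add: P0 P1 hproj_def A_def)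
  moreover have "norm (- l * (y2 - y1), l * (x2 - x1)) = \<bar>l\<bar> * n"
      "norm (l * (y2 - y1), - l * (x2 - x1)) = \<bar>l\<bar> * n"
    by (simp_all add: n_def norm_Pair power_mult_distrib real_sqrt_mult add.commute flip: distrib_left)
  then have "reach A B (\<bar>l\<bar> * n)" "reach (heis_mult g (\<gamma> q)) (\<gamma> q) (\<bar>l\<bar> * n)"
    using reach_segment[of A "- l * (y2 - y1)" "l * (x2 - x1)"]
      reach_segment[of "heis_mult g (\<gamma> q)" "l * (y2 - y1)" "- l * (x2 - x1)"]
      sideways_shift[OF l]
    unfolding A_def B_def g_def P2 by simp_all
  moreover have "reach B (heis_mult g (\<gamma> q)) (k * (q - v))"
    using reach_translate[OF quasigeodesic_reach[OF quasi k(3)], of v q g] q by (simp add: gB)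
  ultimately have "reach (\<gamma> u) (\<gamma> q) (norm (hproj (\<gamma> v) - hproj (\<gamma> u)) + \<bar>l\<bar> * n + k * (q - v) + \<bar>l\<bar> * n)"
    by (blast intro: reach_trans)
  then have "control_dist (\<gamma> u) (\<gamma> q) \<le> norm (hproj (\<gamma> v) - hproj (\<gamma> u)) + \<bar>l\<bar> * n + k * (q - v) + \<bar>l\<bar> * n"
    by (rule control_dist_le_reach)
  moreover have "inverse k * \<bar>u - q\<bar> \<le> control_dist (\<gamma> u) (\<gamma> q)"
    using quasi unfolding quasigeodesic_def by blast
  moreover have "(1 - \<epsilon>) * (L + (q - v)) \<le> inverse k * \<bar>u - q\<bar>"
  proof -
    have "(1 - \<epsilon>) * (1 + \<epsilon>) \<le> 1"
      by (simp add: algebra_simps)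
    then have "1 - \<epsilon> \<le> inverse k"
      using \<epsilon> by (simp add: k_def field_simps)
    moreover have "\<bar>u - q\<bar> = L + (q - v)"
      using q \<open>u < v\<close> by (simp add: L_def)
    ultimately show ?thesis
      using q L by (simp add: mult_right_mono)
  qed
  moreover have "\<bar>l\<bar> * n \<le> 2 * sqrt \<epsilon> * L"
  proof -
    have "\<bar>\<tau>\<bar> \<le> 2 * k\<^sup>2 * L\<^sup>2"
      unfolding \<tau>_def L_def by (rule quasigeodesic_vert[OF quasi])
    also have "\<dots> \<le> 8 * L\<^sup>2"
      using power_mono[of k 2 2] k by (intro mult_right_mono) auto
    finally have "\<bar>\<tau>\<bar> / (4 * n) \<le> 8 * L\<^sup>2 / (4 * (K * L))"
      using n \<open>K * L > 0\<close> by (intro frac_le) auto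
    also have "\<dots> = 2 * (1 / K) * L"
      using L by (simp add: power2_eq_square)
    also have "\<bar>\<tau>\<bar> / (4 * n) = \<bar>l\<bar> * n"
      using \<open>n > 0\<close> by (simp add: l_def power2_eq_square abs_mult)
    finally show ?thesis
      by (simp add: K(3))
  qed
  moreover have "\<epsilon> * (q - v) \<le> 257 * sqrt \<epsilon> * L"
  proof -
    have "\<epsilon> * (q - v) \<le> \<epsilon> * (257 * K * L)"
      using q(2) \<epsilon> by (intro mult_left_mono) auto
    also have "\<dots> = 257 * (\<epsilon> * K) * L"
      by simp
    finally show ?thesis
      by (simp only: K(2))
  qed
  moreover have "\<epsilon> \<le> sqrt \<epsilon>"
    using \<epsilon> by (intro real_le_rsqrt) (simp add: power2_eq_square mult_left_le)
  then have "\<epsilon> * L \<le> sqrt \<epsilon> * L"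
    using L by (intro mult_right_mono) auto
  moreover have "(1 - \<epsilon>) * (L + (q - v)) = L - \<epsilon> * L + (q - v) - \<epsilon> * (q - v)"
      "k * (q - v) = (q - v) + \<epsilon> * (q - v)"
      "(1 - 519 * sqrt \<epsilon>) * (v - u) = L - 519 * (sqrt \<epsilon> * L)"
      "2 * sqrt \<epsilon> * L = 2 * (sqrt \<epsilon> * L)" "257 * sqrt \<epsilon> * L = 257 * (sqrt \<epsilon> * L)"
    by (simp_all add: k_def L_def algebra_simps)
  ultimately show ?thesis
    by linarith
qed

section \<open>Arbitrary bounded intervals\<close>

lemma bounded_interval_cases:
  fixes I :: "real set"
  assumes "is_interval I" "bounded I" "0 < measure lebesgue I"
  obtains u v where "u < v" "I \<subseteq> {u..v}" "{u..v} - I \<subseteq> {u, v}" "measure lebesgue I = v - u"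
proof -
  define u v where "u = Inf I" and "v = Sup I"
  have ne: "I \<noteq> {}"
    using assms(3) by auto
  have sub: "I \<subseteq> {u..v}"
    using bounded_imp_bdd_below[OF assms(2)] bounded_imp_bdd_above[OF assms(2)]
    by (auto simp: u_def v_def intro: cInf_lower cSup_upper)
  have diff: "{u..v} - I \<subseteq> {u, v}"
  proof (rule ccontr)
    assume "\<not> {u..v} - I \<subseteq> {u, v}"
    then obtain x where x: "u < x" "x < v" "x \<notin> I"
      by force
    obtain a b where "a \<in> I" "a < x" "b \<in> I" "x < b"
      using cInf_lessD[OF ne] less_cSupD[OF ne] x(1,2) unfolding u_def v_def by metis
    with assms(1) x(3) show False
      using mem_is_interval_1_I[of I a b x] by simp
  qed
  have "measure lebesgue I = measure lebesgue {u..v}"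
  proof (rule measure_negligible_symdiff)
    have "({u..v} - I) \<union> (I - {u..v}) \<subseteq> {u, v}"
      using sub diff by blast
    then show "negligible (({u..v} - I) \<union> (I - {u..v}))"
      by (rule negligible_subset[rotated]) simp
  qed simp
  moreover have "u \<le> v"
    using ne sub by force
  ultimately have meas: "measure lebesgue I = v - u"
    by simp
  with assms(3) have "u < v"
    by simp
  from that[OF this sub diff meas] show thesis .
qed

theorem theoremA:
  shows "\<exists>\<epsilon>\<^sub>0>0. \<exists>C>0. \<forall>\<epsilon>::real. 0 < \<epsilon> \<and> \<epsilon> \<le> \<epsilon>\<^sub>0 \<longrightarrow>
    (\<forall>\<gamma>. quasigeodesic (1 + \<epsilon>) \<gamma> \<longrightarrow>
      (\<forall>I::real set. is_interval I \<and> bounded I \<and> 0 < measure lebesgue I \<longrightarrow>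
        1 - C * \<epsilon> powr (1/2)
          \<le> norm ((1 / measure lebesgue I) *\<^sub>R (LINT s:I|lebesgue. horizontal_speed \<gamma> s)) \<and>
        norm ((1 / measure lebesgue I) *\<^sub>R (LINT s:I|lebesgue. horizontal_speed \<gamma> s))
          \<le> 1 + C * \<epsilon>))"
proof (rule exI[of _ 1], rule conjI, simp, rule exI[of _ 519], intro conjI allI impI)
  fix \<epsilon> :: real and \<gamma> and I :: "real set"
  \<comment> \<open>The bound 1 on \<epsilon> gives \<open>1 + \<epsilon> \<le> 2\<close> and
    \<open>\<epsilon> \<le> sqrt \<epsilon>\<close>, both used in
    \<open>quasigeodesic_chord_ge\<close>.\<close>
  assume "0 < \<epsilon> \<and> \<epsilon> \<le> 1"
  then have \<epsilon>: "0 < \<epsilon>" "\<epsilon> \<le> 1" by auto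
  assume quasi: "quasigeodesic (1 + \<epsilon>) \<gamma>"
  assume "is_interval I \<and> bounded I \<and> 0 < measure lebesgue I"
  then obtain u v where I: "u < v" "I \<subseteq> {u..v}" "{u..v} - I \<subseteq> {u, v}" "measure lebesgue I = v - u"
    using bounded_interval_cases by metis
  let ?z = "hproj (\<gamma> v) - hproj (\<gamma> u)"
  have neg: "negligible ({u..v} - I)"
    using I(3) by (rule negligible_subset[rotated]) simp
  have "I - {u..v} = {}"
    using I(2) by blast
  then have neg': "negligible (I - {u..v})"
    by simp
  note speed = quasigeodesic_horizontal_speed[OF quasi, of u v]
  have "horizontal_speed \<gamma> absolutely_integrable_on {u..v}"
    using speed(1) \<epsilon> I(1) by simp
  then have "horizontal_speed \<gamma> absolutely_integrable_on I"
    by (rule absolutely_integrable_spike_set)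
      (rule negligible_subset[OF neg] negligible_subset[OF neg'], blast)+
  then have "(LINT s:I|lebesgue. horizontal_speed \<gamma> s) = integral I (horizontal_speed \<gamma>)"
    by (rule set_lebesgue_integral_eq_integral(2))
  also have "\<dots> = integral {u..v} (horizontal_speed \<gamma>)"
    by (rule integral_spike_set)
      (rule negligible_subset[OF neg] negligible_subset[OF neg'], blast)+
  also have "\<dots> = ?z"
    using speed(2) \<epsilon> I(1) by simp
  finally have eq: "norm ((1 / measure lebesgue I) *\<^sub>R (LINT s:I|lebesgue. horizontal_speed \<gamma> s)) = norm ?z / (v - u)"
    using I(1) by (simp add: I(4))
  have "norm ?z \<le> (1 + \<epsilon>) * (v - u)"
    using quasigeodesic_hproj[OF quasi, of v u] I(1) by simp
  then have "norm ?z / (v - u) \<le> 1 + \<epsilon>"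
    using I(1) by (subst pos_divide_le_eq) auto
  then show "norm ((1 / measure lebesgue I) *\<^sub>R (LINT s:I|lebesgue. horizontal_speed \<gamma> s)) \<le> 1 + 519 * \<epsilon>"
    unfolding eq using \<epsilon> by linarith
  have "1 - 519 * sqrt \<epsilon> \<le> norm ?z / (v - u)"
    using quasigeodesic_chord_ge[OF quasi \<epsilon> I(1)] I(1) by (subst pos_le_divide_eq) auto
  then show "1 - 519 * \<epsilon> powr (1/2)
      \<le> norm ((1 / measure lebesgue I) *\<^sub>R (LINT s:I|lebesgue. horizontal_speed \<gamma> s))"
    unfolding eq using \<epsilon> by (simp only: powr_half_sqrt less_imp_le)
qed simp

end
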